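(* Let $T$ be polynomial in $n$ and let $\hat\rho=(\hat\rho_1,\ldots,\hat\rho_T)$ be a $d$-delayed prediction for the transitive closure problem. There is an algorithm solving the transitive closure problem given $\hat\rho$ (without being given $d$) with polynomial preprocessing time $P(n)$, update time $U(n)=\tilde O(1)$ and query time $Q(n)=O(d^2)$.
   Context: Transitive closure (all-pairs reachability): an initial directed graph on $n$ vertices is given; each update inserts or removes a directed edge; each query asks, for a pair $(u,v)$, whether $v$ is reachable from $u$ in the current graph. Requests arrive online and queries must be answered before the next request. A permutation $\pi$ of $[T]$ acts by $\pi(\rho)=(\rho_{\pi(1)},\ldots,\rho_{\pi(T)})$ and is $d$-close to the identity if $|\pi^{-1}(t)-t|\le d$ for all $t$; $\hat\rho$ is $d$-delayed for the actual request sequence $\rho$ if $\pi(\rho)=\hat\rho$ for some such $\pi$. $\tilde O$ hides polylogarithmic factors. *)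

theory Defs
  imports
    Complex_Main
    "HOL-Library.Landau_Symbols"
    "HOL-Library.Discrete_Functions"
    "HOL-Combinatorics.Permutations"
begin

subsection \<open>The word RAM\<close>

text \<open>
  Programs of a word RAM in structured form. The memory consists of arrays of words; a program
  names the arrays it uses statically, so it uses only a constant number of them (a single flat
  memory simulates them by interleaving, with constant overhead). A scalar variable is a cell
  with constant index. Words have \<open>w\<close> bits: every operation yields a value below
  \<open>2 ^ w\<close>, and hence every address is below \<open>2 ^ w\<close> as well.
\<close>

type_synonym mem = "nat \<Rightarrow> nat \<Rightarrow> nat"

datatype binop = Add | Sub | Mul | Div | Mod | Less | Eq

datatype expr =
    Const nat
  | Read nat expr
  | Op binop expr expr

datatype com =
    Skip
  | Write nat expr expr
  | Seq com com
  | If expr com com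
  | While expr com

text \<open>\<open>Sub\<close> is truncated at 0; division and remainder by 0 are those of \<open>nat\<close>.\<close>

fun binop_val :: "binop \<Rightarrow> nat \<Rightarrow> nat \<Rightarrow> nat" where
  "binop_val Add x y = x + y"
| "binop_val Sub x y = x - y"
| "binop_val Mul x y = x * y"
| "binop_val Div x y = x div y"
| "binop_val Mod x y = x mod y"
| "binop_val Less x y = of_bool (x < y)"
| "binop_val Eq x y = of_bool (x = y)"

fun eval :: "nat \<Rightarrow> mem \<Rightarrow> expr \<Rightarrow> nat" where
  "eval w m (Const a) = a mod 2 ^ w"
| "eval w m (Read k e) = m k (eval w m e)"
| "eval w m (Op f e1 e2) = binop_val f (eval w m e1) (eval w m e2) mod 2 ^ w"

fun cost :: "expr \<Rightarrow> nat" where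
  "cost (Const a) = 1"
| "cost (Read k e) = 1 + cost e"
| "cost (Op f e1 e2) = 1 + cost e1 + cost e2"

definition store :: "mem \<Rightarrow> nat \<Rightarrow> nat \<Rightarrow> nat \<Rightarrow> mem" where
  "store m k i x = m(k := (m k)(i := x))"

text \<open>
  \<open>exec w c m t m'\<close>: on words of \<open>w\<close> bits, the program \<open>c\<close> started in
  memory \<open>m\<close> halts after \<open>t\<close> elementary steps in memory \<open>m'\<close>.
\<close>

inductive exec :: "nat \<Rightarrow> com \<Rightarrow> mem \<Rightarrow> nat \<Rightarrow> mem \<Rightarrow> bool" for w :: nat where
  Skip: "exec w Skip m 1 m"
| Write: "exec w (Write k e1 e2) m (1 + cost e1 + cost e2) (store m k (eval w m e1) (eval w m e2))"
| Seq: "exec w c1 m t1 m1 \<Longrightarrow> exec w c2 m1 t2 m2 \<Longrightarrow> exec w (Seq c1 c2) m (t1 + t2) m2"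
| IfTrue: "eval w m e \<noteq> 0 \<Longrightarrow> exec w c1 m t m1 \<Longrightarrow> exec w (If e c1 c2) m (1 + cost e + t) m1"
| IfFalse: "eval w m e = 0 \<Longrightarrow> exec w c2 m t m1 \<Longrightarrow> exec w (If e c1 c2) m (1 + cost e + t) m1"
| WhileFalse: "eval w m e = 0 \<Longrightarrow> exec w (While e c) m (1 + cost e) m"
| WhileTrue: "eval w m e \<noteq> 0 \<Longrightarrow> exec w c m t1 m1 \<Longrightarrow> exec w (While e c) m1 t2 m2
    \<Longrightarrow> exec w (While e c) m (1 + cost e + t1 + t2) m2"

inductive_cases exec_SkipE: "exec w Skip m t m'"
inductive_cases exec_WriteE: "exec w (Write k e1 e2) m t m'"
inductive_cases exec_SeqE: "exec w (Seq c1 c2) m t m'"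
inductive_cases exec_IfE: "exec w (If e c1 c2) m t m'"
inductive_cases exec_WhileE: "exec w (While e c) m t m'"

lemma exec_deterministic:
  "exec w c m t m1 \<Longrightarrow> exec w c m t' m2 \<Longrightarrow> t' = t \<and> m2 = m1"
proof (induction arbitrary: t' m2 rule: exec.induct)
  case (Skip m)
  then show ?case by (auto elim: exec_SkipE)
next
  case (Write k e1 e2 m)
  then show ?case by (auto elim: exec_WriteE)
next
  case (Seq c1 m t1 m1 c2 t2 m2')
  from Seq.prems obtain s1 n1 s2 where "exec w c1 m s1 n1" "exec w c2 n1 s2 m2" "t' = s1 + s2"
    by (auto elim: exec_SeqE)
  with Seq.IH show ?case by metis
next
  case (IfTrue m e c1 t m1 c2)
  from IfTrue.prems IfTrue.hyps obtain s where "exec w c1 m s m2" "t' = 1 + cost e + s"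
    by (auto elim: exec_IfE)
  with IfTrue.IH show ?case by metis
next
  case (IfFalse m e c2 t m1 c1)
  from IfFalse.prems IfFalse.hyps obtain s where "exec w c2 m s m2" "t' = 1 + cost e + s"
    by (auto elim: exec_IfE)
  with IfFalse.IH show ?case by metis
next
  case (WhileFalse m e c)
  from WhileFalse.prems show ?case
    by (rule exec_WhileE) (use WhileFalse.hyps in simp_all)
next
  case (WhileTrue m e c t1 m1 t2 m2')
  from WhileTrue.prems obtain s1 n1 s2 where
    "exec w c m s1 n1" "exec w (While e c) n1 s2 m2" "t' = 1 + cost e + s1 + s2"
    by (rule exec_WhileE) (use WhileTrue.hyps in simp_all)
  with WhileTrue.IH show ?case by metis
qed

text \<open>\<open>c\<close> times the bit length of \<open>n\<close>.\<close>

definition word_bits :: "nat \<Rightarrow> nat \<Rightarrow> nat" where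
  "word_bits c n = c * (floor_log n + 1)"

subsection \<open>Dynamic transitive closure\<close>

type_synonym digraph = "(nat \<times> nat) set"

datatype request = Insert nat nat | Delete nat nat | Query nat nat

fun tag :: "request \<Rightarrow> nat" where
  "tag (Insert u v) = 0"
| "tag (Delete u v) = 1"
| "tag (Query u v) = 2"

fun src :: "request \<Rightarrow> nat" where
  "src (Insert u v) = u"
| "src (Delete u v) = u"
| "src (Query u v) = u"

fun tgt :: "request \<Rightarrow> nat" where
  "tgt (Insert u v) = v"
| "tgt (Delete u v) = v"
| "tgt (Query u v) = v"

fun apply_request :: "request \<Rightarrow> digraph \<Rightarrow> digraph" where
  "apply_request (Insert u v) G = insert (u, v) G"
| "apply_request (Delete u v) G = G - {(u, v)}"
| "apply_request (Query u v) G = G"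

fun admissible :: "request \<Rightarrow> digraph \<Rightarrow> bool" where
  "admissible (Insert u v) G \<longleftrightarrow> (u, v) \<notin> G"
| "admissible (Delete u v) G \<longleftrightarrow> (u, v) \<in> G"
| "admissible (Query u v) G \<longleftrightarrow> True"

text \<open>
  The graphs are simple: along a request sequence an edge is inserted only when absent and
  removed only when present.
\<close>

fun valid_requests :: "nat \<Rightarrow> digraph \<Rightarrow> request list \<Rightarrow> bool" where
  "valid_requests n G [] \<longleftrightarrow> True"
| "valid_requests n G (r # rs) \<longleftrightarrow>
     src r < n \<and> tgt r < n \<and> admissible r G \<and> valid_requests n (apply_request r G) rs"

subsection \<open>Delayed predictions\<close>

text \<open>Positions are counted from 0.\<close>

definition close_to_id :: "nat \<Rightarrow> nat \<Rightarrow> (nat \<Rightarrow> nat) \<Rightarrow> bool" where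
  "close_to_id T d \<pi> \<longleftrightarrow>
     \<pi> permutes {..<T} \<and> (\<forall>t<T. \<bar>int (inv \<pi> t) - int t\<bar> \<le> int d)"

definition delayed :: "nat \<Rightarrow> request list \<Rightarrow> request list \<Rightarrow> bool" where
  "delayed d \<rho> \<rho>h \<longleftrightarrow> (\<exists>\<pi>. close_to_id (length \<rho>) d \<pi> \<and> permute_list \<pi> \<rho> = \<rho>h)"

subsection \<open>Algorithms with predictions\<close>

record algorithm =
  preprocess :: com
  update :: com
  query :: com

fun handler :: "algorithm \<Rightarrow> request \<Rightarrow> com" where
  "handler A (Insert u v) = update A"
| "handler A (Delete u v) = update A"
| "handler A (Query u v) = query A"

text \<open>
  Input and output conventions. Before preprocessing, array 0 holds \<open>n\<close> and the number of
  predicted requests, array 1 the adjacency matrix of the initial graph in row-major order, and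
  arrays 2, 3, 4 the tags, sources and targets of the predicted requests; all other cells are 0.
  Each arriving request is written to the first three cells of array 5; the answer to a query is
  read off the first cell of array 6. The memory persists between requests, and it is the only
  information that a handler has, so it knows the past requests only.
\<close>

definition initial_mem :: "nat \<Rightarrow> nat \<Rightarrow> digraph \<Rightarrow> request list \<Rightarrow> mem" where
  "initial_mem w n G \<rho>h = (\<lambda>k i.
     (if k = 0 \<and> i = 0 then n
      else if k = 0 \<and> i = 1 then length \<rho>h
      else if k = 1 then of_bool ((i div n, i mod n) \<in> G)
      else if k = 2 \<and> i < length \<rho>h then tag (\<rho>h ! i)
      else if k = 3 \<and> i < length \<rho>h then src (\<rho>h ! i)
      else if k = 4 \<and> i < length \<rho>h then tgt (\<rho>h ! i)
      else 0) mod 2 ^ w)"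

definition load_request :: "nat \<Rightarrow> request \<Rightarrow> mem \<Rightarrow> mem" where
  "load_request w r m =
     store (store (store m 5 0 (tag r mod 2 ^ w)) 5 1 (src r mod 2 ^ w)) 5 2 (tgt r mod 2 ^ w)"

fun correct_answer :: "request \<Rightarrow> digraph \<Rightarrow> mem \<Rightarrow> bool" where
  "correct_answer (Query u v) G m \<longleftrightarrow> m 6 0 = of_bool ((u, v) \<in> G\<^sup>*)"
| "correct_answer (Insert u v) G m \<longleftrightarrow> True"
| "correct_answer (Delete u v) G m \<longleftrightarrow> True"

fun time_bound :: "nat \<Rightarrow> nat \<Rightarrow> request \<Rightarrow> nat" where
  "time_bound ut qt (Insert u v) = ut"
| "time_bound ut qt (Delete u v) = ut"
| "time_bound ut qt (Query u v) = qt"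

text \<open>
  \<open>ut\<close> and \<open>qt\<close> are worst-case bounds for every single update and query.
\<close>

fun serves :: "nat \<Rightarrow> algorithm \<Rightarrow> nat \<Rightarrow> nat \<Rightarrow> digraph \<Rightarrow> request list \<Rightarrow> mem \<Rightarrow> bool" where
  "serves w A ut qt G [] m \<longleftrightarrow> True"
| "serves w A ut qt G (r # rs) m \<longleftrightarrow>
     (\<exists>t m'. exec w (handler A r) (load_request w r m) t m' \<and> t \<le> time_bound ut qt r \<and>
        correct_answer r G m' \<and> serves w A ut qt (apply_request r G) rs m')"

definition solves ::
  "nat \<Rightarrow> algorithm \<Rightarrow> nat \<Rightarrow> digraph \<Rightarrow> request list \<Rightarrow> request list \<Rightarrow> nat \<Rightarrow> nat \<Rightarrow> nat \<Rightarrow> bool" where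
  "solves w A n G \<rho>h \<rho> pt ut qt \<longleftrightarrow>
     (\<exists>t m. exec w (preprocess A) (initial_mem w n G \<rho>h) t m \<and> t \<le> pt \<and>
        serves w A ut qt G \<rho> m)"

subsection \<open>Growth rates\<close>

definition polynomially_bounded :: "(nat \<Rightarrow> nat) \<Rightarrow> bool" where
  "polynomially_bounded f \<longleftrightarrow> (\<exists>k. (\<lambda>n. real (f n)) \<in> O(\<lambda>n. real n ^ k))"

definition polylog_bounded :: "(nat \<Rightarrow> nat) \<Rightarrow> bool" where
  "polylog_bounded f \<longleftrightarrow> (\<exists>k. (\<lambda>n. real (f n)) \<in> O(\<lambda>n. ln (real n) ^ k))"

end

theory Submission
  imports Defs
begin

text \<open>
  Give every request a key: the edge it updates, or one common key for all queries. An edge is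
  present iff the parity of the number of its updates so far (\<open>occ\<close>), plus its initial presence,
  is odd. The algorithm keeps two positions \<open>a \<le> b\<close> in the prediction such that, for every
  key, \<open>occ\<close> lies between its number of occurrences in the first \<open>a\<close> and in the first \<open>b\<close>
  predicted requests. A request moves \<open>b\<close> past the predicted position of the same occurrence of
  its key, and moves \<open>a\<close> by at most one. After \<open>t\<close> requests with a \<open>d\<close>-delayed prediction,
  \<open>t - d \<le> a\<close> and \<open>b \<le> t + d\<close>: \<open>a\<close> is blocked only at an occurrence that has not arrived
  yet, and this needs \<open>t \<le> a + d\<close>.

  An edge that does not occur in the window \<open>[a, b)\<close> has the same state in the current graph and
  in the prediction. Preprocessing tabulates, for all \<open>a\<close> and \<open>b\<close>, the transitive closure of these
  edges; a query searches the graph formed by the at most \<open>2 d\<close> remaining edges, using the table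
  to move between them, in time \<open>O((b - a + 1)\<^sup>2)\<close>. Neither part refers to \<open>d\<close>.
\<close>

section \<open>Total correctness with step counts for word RAM programs\<close>

section \<open>Program logic\<close>

fun writes :: "com \<Rightarrow> nat set" where
  "writes Skip = {}"
| "writes (Write k e1 e2) = {k}"
| "writes (Seq c1 c2) = writes c1 \<union> writes c2"
| "writes (If e c1 c2) = writes c1 \<union> writes c2"
| "writes (While e c) = writes c"

definition agree_off :: "nat set \<Rightarrow> mem \<Rightarrow> mem \<Rightarrow> bool" where
  "agree_off K m m' \<longleftrightarrow> (\<forall>k. k \<notin> K \<longrightarrow> m' k = m k)"

lemma agree_offD: "agree_off K m m' \<Longrightarrow> k \<notin> K \<Longrightarrow> m' k = m k"
  by (simp add: agree_off_def)

lemma exec_agree_off: "exec w c m t m' \<Longrightarrow> agree_off (writes c) m m'"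
  by (induction rule: exec.induct) (auto simp: agree_off_def store_def)

definition runs :: "nat \<Rightarrow> com \<Rightarrow> mem \<Rightarrow> nat \<Rightarrow> (mem \<Rightarrow> bool) \<Rightarrow> bool" where
  "runs w c m B Q \<longleftrightarrow> (\<exists>t m'. exec w c m t m' \<and> t \<le> B \<and> Q m')"

lemma runs_weaken:
  "runs w c m B Q \<Longrightarrow> B \<le> B' \<Longrightarrow> (\<And>m'. agree_off (writes c) m m' \<Longrightarrow> Q m' \<Longrightarrow> Q' m')
    \<Longrightarrow> runs w c m B' Q'"
  unfolding runs_def by (meson exec_agree_off order_trans)

text \<open>The frame condition of \<open>c1\<close> is handed on to \<open>c2\<close>, so facts
  about arrays that \<open>c1\<close> does not write need not enter its postcondition.\<close>

lemma runs_Seq: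
  assumes "runs w c1 m B1 Q1" "\<And>m'. agree_off (writes c1) m m' \<Longrightarrow> Q1 m' \<Longrightarrow> runs w c2 m' B2 Q"
  shows "runs w (Seq c1 c2) m (B1 + B2) Q"
  using assms unfolding runs_def by (meson exec.Seq exec_agree_off add_mono)

fun loop_free :: "com \<Rightarrow> bool" where
  "loop_free (Seq c1 c2) \<longleftrightarrow> loop_free c1 \<and> loop_free c2"
| "loop_free (If e c1 c2) \<longleftrightarrow> loop_free c1 \<and> loop_free c2"
| "loop_free (While e c) \<longleftrightarrow> False"
| "loop_free c \<longleftrightarrow> True"

text \<open>Symbolic execution of loop-free programs. The last equation gives \<open>While\<close> a
  dummy value, which \<open>loop_free\<close> excludes.\<close>

fun result :: "nat \<Rightarrow> com \<Rightarrow> mem \<Rightarrow> mem" where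
  "result w (Write k e1 e2) m = store m k (eval w m e1) (eval w m e2)"
| "result w (Seq c1 c2) m = result w c2 (result w c1 m)"
| "result w (If e c1 c2) m = (if eval w m e \<noteq> 0 then result w c1 m else result w c2 m)"
| "result w c m = m"

fun time_limit :: "com \<Rightarrow> nat" where
  "time_limit (Write k e1 e2) = 1 + cost e1 + cost e2"
| "time_limit (Seq c1 c2) = time_limit c1 + time_limit c2"
| "time_limit (If e c1 c2) = 1 + cost e + max (time_limit c1) (time_limit c2)"
| "time_limit c = 1"

lemma exec_loop_free: "loop_free c \<Longrightarrow> \<exists>t\<le>time_limit c. exec w c m t (result w c m)"
proof (induction c arbitrary: m)
  case (Seq c1 c2)
  from Seq obtain t1 t2 where "t1 \<le> time_limit c1" "exec w c1 m t1 (result w c1 m)"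
    "t2 \<le> time_limit c2" "exec w c2 (result w c1 m) t2 (result w c2 (result w c1 m))" by fastforce
  then show ?case using exec.Seq by (intro exI[of _ "t1 + t2"]) auto
next
  case (If e c1 c2)
  from If obtain t1 t2 where "t1 \<le> time_limit c1" "exec w c1 m t1 (result w c1 m)"
    "t2 \<le> time_limit c2" "exec w c2 m t2 (result w c2 m)" by fastforce
  then show ?case
    using exec.IfTrue[of w m e c1 t1 "result w c1 m" c2]
      exec.IfFalse[of w m e c2 t2 "result w c2 m" c1]
    by (intro exI[of _ "1 + cost e + (if eval w m e = 0 then t2 else t1)"]) auto
next
  case Skip
  show ?case using exec.Skip by fastforce
next
  case (Write k e1 e2)
  show ?case using exec.Write by fastforce
qed simp

lemma runs_loop_free: "loop_free c \<Longrightarrow> Q (result w c m) \<Longrightarrow> time_limit c \<le> B \<Longrightarrow> runs w c m B Q"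
  unfolding runs_def using exec_loop_free[of c w m] by (meson order_trans)

text \<open>The index \<open>j\<close> counts completed iterations. A true guard forces
  \<open>j < L\<close>, so \<open>L - j\<close> is a variant; each remaining iteration pays for
  guard and body, and the failing guard test is added once.\<close>

lemma runs_While:
  assumes "I j m" "j \<le> L"
    and body: "\<And>j m'. I j m' \<Longrightarrow> eval w m' e \<noteq> 0 \<Longrightarrow> j < L \<and> runs w c m' B (I (Suc j))"
  shows "runs w (While e c) m ((L - j) * (B + 1 + cost e) + (1 + cost e))
    (\<lambda>m'. \<exists>j. I j m' \<and> eval w m' e = 0)"
  using assms(1,2)
proof (induction "L - j" arbitrary: j m)
  case 0
  with body[of j m] have "eval w m e = 0" by auto
  with 0 show ?case unfolding runs_def by (metis exec.WhileFalse le_add2)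
next
  case (Suc k)
  show ?case
  proof (cases "eval w m e = 0")
    case True
    with Suc show ?thesis unfolding runs_def by (metis exec.WhileFalse le_add2)
  next
    case False
    with body[of j m] Suc obtain t1 m1 where 1: "exec w c m t1 m1" "t1 \<le> B" "I (Suc j) m1" "j < L"
      unfolding runs_def by blast
    have k: "k = L - Suc j" using Suc(2) by simp
    from Suc(1)[OF k 1(3)] 1(4) obtain t2 m2 where 2: "exec w (While e c) m1 t2 m2"
      "t2 \<le> k * (B + 1 + cost e) + (1 + cost e)" "\<exists>j. I j m2 \<and> eval w m2 e = 0"
      unfolding runs_def k[symmetric] by auto
    have "exec w (While e c) m (1 + cost e + t1 + t2) m2"
      using False 1 2 exec.WhileTrue by blast
    moreover have "1 + cost e + t1 + t2 \<le> (L - j) * (B + 1 + cost e) + (1 + cost e)"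
      using 1 2 Suc(2)[symmetric] by simp
    ultimately show ?thesis using 2 unfolding runs_def by blast
  qed
qed

abbreviation Var :: "nat \<Rightarrow> expr" where
  "Var k \<equiv> Read k (Const 0)"

definition For :: "nat \<Rightarrow> expr \<Rightarrow> expr \<Rightarrow> com \<Rightarrow> com" where
  "For v e0 e1 c = Seq (Write v (Const 0) e0)
     (While (Op Less (Var v) e1) (Seq c (Write v (Const 0) (Op Add (Var v) (Const 1)))))"

lemma writes_For [simp]: "writes (For v e0 e1 c) = insert v (writes c)"
  by (auto simp: For_def)

text \<open>The bound \<open>e1\<close> is re-evaluated before every iteration, hence
  \<open>lim\<close> asks for a value that is stable under the writes of the loop.
  \<open>L < 2 ^ w\<close> keeps the counter from wrapping around. Per iteration, the increment
  takes 6 steps and the guard \<open>cost e1 + 4\<close>.\<close>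

lemma runs_For:
  assumes e0: "eval w m e0 = s" and "s \<le> L" "L < 2 ^ w" and v: "v \<notin> writes c"
    and lim: "\<And>m'. agree_off (insert v (writes c)) m m' \<Longrightarrow> eval w m' e1 = L"
    and init: "I s m"
    and indep: "\<And>i m' x. I i m' \<Longrightarrow> I i (store m' v 0 x)"
    and body: "\<And>i m'. s \<le> i \<Longrightarrow> i < L \<Longrightarrow> m' v 0 = i \<Longrightarrow> agree_off (insert v (writes c)) m m'
      \<Longrightarrow> I i m' \<Longrightarrow> runs w c m' B (I (Suc i))"
  shows "runs w (For v e0 e1 c) m ((L - s) * (B + cost e1 + 10) + (cost e0 + cost e1 + 10)) (I L)"
proof -
  define J where "J j m' \<longleftrightarrow>
    s \<le> j \<and> j \<le> L \<and> m' v 0 = j \<and> agree_off (insert v (writes c)) m m' \<and> I j m'" for j m'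
  let ?c = "Seq c (Write v (Const 0) (Op Add (Var v) (Const 1)))"
  let ?e = "Op Less (Var v) e1"
  have J0: "J s (store m v 0 s)"
    using init indep \<open>s \<le> L\<close> by (auto simp: J_def store_def agree_off_def)
  have step: "j < L \<and> runs w ?c m' (B + 6) (J (Suc j))"
    if J: "J j m'" and ne: "eval w m' ?e \<noteq> 0" for j m'
  proof -
    have "j < L"
      using J ne lim[of m'] by (cases "j < L") (auto simp: J_def)
    moreover have "runs w ?c m' (B + 6) (J (Suc j))"
    proof (rule runs_Seq)
      show "runs w c m' B (I (Suc j))" using body J \<open>j < L\<close> by (auto simp: J_def)
      fix m1 assume m1: "agree_off (writes c) m' m1" "I (Suc j) m1"
      then have "m1 v 0 = j" using v J by (auto simp: J_def agree_off_def)
      moreover have "0 < w" using \<open>j < L\<close> \<open>L < 2 ^ w\<close> by (cases w) auto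
      moreover have "(j + 1) mod 2 ^ w = Suc j" using \<open>j < L\<close> \<open>L < 2 ^ w\<close> by simp
      ultimately show "runs w (Write v (Const 0) (Op Add (Var v) (Const 1))) m1 6 (J (Suc j))"
        using m1 J \<open>j < L\<close> indep
        by (intro runs_loop_free) (auto simp: J_def agree_off_def store_def mod_simps)
    qed
    ultimately show ?thesis by blast
  qed
  have "runs w (For v e0 e1 c) m ((2 + cost e0) + ((L - s) * (B + 6 + 1 + cost ?e) + (1 + cost ?e)))
      (\<lambda>m'. \<exists>j. J j m' \<and> eval w m' ?e = 0)"
    unfolding For_def
  proof (rule runs_Seq)
    show "runs w (Write v (Const 0) e0) m (2 + cost e0) (\<lambda>m'. m' = store m v 0 s)"
      using e0 by (intro runs_loop_free) auto
    fix m' assume "m' = store m v 0 s"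
    then show "runs w (While ?e ?c) m' ((L - s) * (B + 6 + 1 + cost ?e) + (1 + cost ?e))
      (\<lambda>m'. \<exists>j. J j m' \<and> eval w m' ?e = 0)"
      using J0 \<open>s \<le> L\<close> step by (intro runs_While) auto
  qed
  then show ?thesis
  proof (rule runs_weaken)
    fix m' assume "\<exists>j. J j m' \<and> eval w m' ?e = 0"
    then obtain j where j: "J j m'" "eval w m' ?e = 0" by blast
    \<comment> \<open>For \<open>w = 0\<close> even a true comparison evaluates to 0, but then
      \<open>L = 0\<close> and the loop is empty.\<close>
    have "1 < (2::nat) ^ w \<or> L = 0" using \<open>L < 2 ^ w\<close> by (cases w) auto
    with j lim[of m'] have "j = L"
      by (cases "j < L") (auto simp: J_def)
    then show "I L m'" using j by (simp add: J_def)
  qed (simp add: algebra_simps)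
qed

section \<open>Occurrence numbers of keys in prefixes of a list\<close>

section \<open>Counting occurrences in prefixes\<close>

definition cnt :: "'a list \<Rightarrow> nat \<Rightarrow> 'a \<Rightarrow> nat" where
  "cnt ks i e = count_list (take i ks) e"

lemma cnt_0 [simp]: "cnt ks 0 e = 0"
  by (simp add: cnt_def)

lemma cnt_Suc: "i < length ks \<Longrightarrow> cnt ks (Suc i) e = cnt ks i e + of_bool (ks ! i = e)"
  by (simp add: cnt_def take_Suc_conv_app_nth)

lemma cnt_mono: "i \<le> j \<Longrightarrow> cnt ks i e \<le> cnt ks j e"
proof -
  assume "i \<le> j"
  then have "take j ks = take i ks @ take (j - i) (drop i ks)"
    by (metis le_add_diff_inverse take_add)
  then show ?thesis by (simp add: cnt_def)
qed

lemma cnt_le: "cnt ks i e \<le> i"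
  unfolding cnt_def using count_le_length[of "take i ks" e] by simp

lemma cnt_less: "j < i \<Longrightarrow> j < length ks \<Longrightarrow> cnt ks j (ks ! j) < cnt ks i (ks ! j)"
  using cnt_mono[of "Suc j" i ks "ks ! j"] cnt_Suc[of j ks "ks ! j"] by simp

text \<open>A key together with its occurrence number determines a position, because each occurrence
  strictly raises the count. This makes the position table well defined.\<close>

lemma cnt_inj:
  assumes "i < length ks" "j < length ks" "ks ! i = ks ! j" "cnt ks i (ks ! i) = cnt ks j (ks ! j)"
  shows "i = j"
  using assms cnt_less[of i j ks] cnt_less[of j i ks] by (metis less_irrefl nat_neq_iff)

lemma cnt_neq_imp_between:
  assumes "cnt ks a e \<noteq> cnt ks b e" "a \<le> b" "b \<le> length ks"
  shows "\<exists>i. a \<le> i \<and> i < b \<and> ks ! i = e"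
  using assms(2,1,3)
proof (induction b rule: dec_induct)
  case (step b)
  then show ?case
    by (cases "ks ! b = e") (auto simp: cnt_Suc less_Suc_eq)
qed simp

text \<open>A discrete intermediate value argument: the count starts at 0 and grows in steps of at
  most one, so somewhere before \<open>i\<close> it leaves the value \<open>k\<close>, and the entry
  there is \<open>e\<close>.\<close>

lemma occurrence_exists:
  assumes "k < cnt ks i e" "i \<le> length ks"
  shows "\<exists>j<i. ks ! j = e \<and> cnt ks j e = k"
  using assms
proof (induction i)
  case (Suc i)
  show ?case
  proof (cases "k < cnt ks i e")
    case True
    with Suc show ?thesis using less_SucI by fastforce
  next
    case False
    with Suc.prems show ?thesis by (cases "ks ! i = e") (auto simp: cnt_Suc)
  qed
qed simp

lemma cnt_conv_card: "cnt ks i e = card {j. j < i \<and> j < length ks \<and> ks ! j = e}"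
proof (induction i)
  case (Suc i)
  show ?case
  proof (cases "i < length ks")
    case True
    have "{j. j < Suc i \<and> j < length ks \<and> ks ! j = e} =
      (if ks ! i = e then insert i else id) {j. j < i \<and> j < length ks \<and> ks ! j = e}"
      using True by (auto simp: less_Suc_eq)
    with True Suc show ?thesis by (simp add: cnt_Suc)
  next
    case False
    then have "{j. j < Suc i \<and> j < length ks \<and> ks ! j = e} = {j. j < i \<and> j < length ks \<and> ks ! j = e}"
      by auto
    with False Suc show ?thesis by (simp add: cnt_def)
  qed
qed simp

text \<open>\<open>f\<close> maps the occurrences of \<open>e\<close> among the first
  \<open>i\<close> entries of \<open>ks\<close> injectively to occurrences among the first
  \<open>i + d\<close> entries of \<open>ls\<close>.\<close>

lemma cnt_le_shifted:
  assumes "inj_on f {..<length ks}" "\<And>i. i < length ks \<Longrightarrow> f i < length ls \<and> f i \<le> i + d \<and> ls ! f i = ks ! i"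
  shows "cnt ks i e \<le> cnt ls (i + d) e"
  unfolding cnt_conv_card
proof (rule card_inj_on_le[of f])
  show "f ` {j. j < i \<and> j < length ks \<and> ks ! j = e} \<subseteq> {j. j < i + d \<and> j < length ls \<and> ls ! j = e}"
    using assms(2) by fastforce
qed (auto intro: inj_on_subset[OF assms(1)])

section \<open>Occurrence counts under a delayed prediction\<close>

lemma delayed_length: "delayed d \<rho> \<rho>h \<Longrightarrow> length \<rho>h = length \<rho>"
  by (auto simp: delayed_def)

lemma delayed_set: "delayed d \<rho> \<rho>h \<Longrightarrow> set \<rho>h = set \<rho>"
  by (auto simp: delayed_def close_to_id_def)

text \<open>The permutation and its inverse both move positions forward by at most \<open>d\<close>.
  The first inequality later controls the upper end of the window, the second one the lower
  end.\<close>

lemma delayed_cnt: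
  assumes "delayed d \<rho> \<rho>h"
  shows "cnt (map f \<rho>) i e \<le> cnt (map f \<rho>h) (i + d) e" "cnt (map f \<rho>h) i e \<le> cnt (map f \<rho>) (i + d) e"
proof -
  from assms obtain \<pi> where perm: "\<pi> permutes {..<length \<rho>}"
    and close: "\<And>t. t < length \<rho> \<Longrightarrow> \<bar>int (inv \<pi> t) - int t\<bar> \<le> int d"
    and \<rho>h: "\<rho>h = permute_list \<pi> \<rho>"
    unfolding delayed_def close_to_id_def by blast
  have bnd: "\<pi> i < length \<rho>" "inv \<pi> i < length \<rho>" if "i < length \<rho>" for i
    using permutes_in_image[OF perm, of i] permutes_in_image[OF permutes_inv[OF perm], of i] that
    by auto
  have nth: "\<rho>h ! i = \<rho> ! \<pi> i" if "i < length \<rho>" for i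
    using permute_list_nth[OF perm that] \<rho>h by simp
  have inv: "\<pi> (inv \<pi> i) = i" "inv \<pi> (\<pi> i) = i" for i
    using perm permutes_inverses by fastforce+
  have "inv \<pi> i \<le> i + d" if "i < length \<rho>" for i
    using close[OF that] by linarith
  \<comment> \<open>Closeness is a condition on the inverse; applied at the position
    \<open>\<pi> i\<close> it bounds \<open>\<pi> i\<close> itself.\<close>
  moreover have "\<pi> i \<le> i + d" if "i < length \<rho>" for i
    using close[OF bnd(1)[OF that]] inv by simp
  moreover have "inj_on \<pi> A" "inj_on (inv \<pi>) A" for A
    using inv by (metis inj_on_inverseI)+
  ultimately show "cnt (map f \<rho>) i e \<le> cnt (map f \<rho>h) (i + d) e"
    "cnt (map f \<rho>h) i e \<le> cnt (map f \<rho>) (i + d) e"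
    using bnd nth inv delayed_length[OF assms]
    by (intro cnt_le_shifted[of "inv \<pi>"] cnt_le_shifted[of \<pi>]; simp)+
qed

section \<open>Warshall's closure, and reachability through a few extra edges\<close>

section \<open>Reachability\<close>

text \<open>Stage \<open>k\<close> of Warshall's algorithm: walks all of whose inner vertices lie
  below \<open>k\<close>.\<close>

fun warshall :: "(nat \<times> nat) set \<Rightarrow> nat \<Rightarrow> (nat \<times> nat) set" where
  "warshall R 0 = R\<^sup>="
| "warshall R (Suc k) = warshall R k \<union> {(x, y). (x, k) \<in> warshall R k \<and> (k, y) \<in> warshall R k}"

lemma warshall_sound: "warshall R k \<subseteq> R\<^sup>*"
  by (induction k) (auto intro: rtrancl_trans)

text \<open>When the stage grows past \<open>k\<close> and \<open>z\<close> is smaller than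
  \<open>k\<close>, each of the two pairs is either old or splits at \<open>k\<close>; the induction
  hypothesis joins the pieces at \<open>z\<close> where needed.\<close>

lemma warshall_trans:
  "z < k \<Longrightarrow> (x, z) \<in> warshall R k \<Longrightarrow> (z, y) \<in> warshall R k \<Longrightarrow> (x, y) \<in> warshall R k"
proof (induction k arbitrary: x y z)
  case (Suc k)
  show ?case
  proof (cases "z = k")
    case True
    with Suc.prems show ?thesis by auto
  next
    case False
    with Suc.prems have "z < k" by simp
    from Suc.IH[OF this] Suc.prems(2,3) show ?thesis by auto
  qed
qed simp

lemma warshall_base: "R\<^sup>= \<subseteq> warshall R k"
  by (induction k) auto

lemma warshall_complete:
  assumes "R \<subseteq> {..<n} \<times> {..<n}"
  shows "warshall R n = R\<^sup>*"
proof
  show "R\<^sup>* \<subseteq> warshall R n"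
  proof clarify
    fix x y assume "(x, y) \<in> R\<^sup>*"
    then show "(x, y) \<in> warshall R n"
    proof (induction rule: rtrancl_induct)
      case base
      show ?case using warshall_base by blast
    next
      case (step y z)
      then have "(y, z) \<in> warshall R n" using warshall_base by blast
      \<comment> \<open>As the source of an edge, \<open>y\<close> is below \<open>n\<close>, so the
        walk so far and the next edge can be joined at \<open>y\<close>.\<close>
      moreover have "y < n" using step assms by auto
      ultimately show ?case using warshall_trans step by blast
    qed
  qed
qed (rule warshall_sound)

text \<open>\<open>X\<close> collects \<open>u\<close> and the heads of the extra edges found so far.\<close>

lemma rtrancl_via_extra_edges:
  assumes "R \<subseteq> S" "S \<subseteq> R \<union> F" "u \<in> X" "\<And>z. z \<in> X \<Longrightarrow> (u, z) \<in> S\<^sup>*"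
    and closed: "\<And>z x y. z \<in> X \<Longrightarrow> (z, x) \<in> R\<^sup>* \<Longrightarrow> (x, y) \<in> S \<Longrightarrow> (x, y) \<in> F \<Longrightarrow> y \<in> X"
  shows "(u, v) \<in> S\<^sup>* \<longleftrightarrow> (\<exists>z\<in>X. (z, v) \<in> R\<^sup>*)"
proof
  assume "(u, v) \<in> S\<^sup>*"
  then show "\<exists>z\<in>X. (z, v) \<in> R\<^sup>*"
  proof (induction rule: rtrancl_induct)
    case base
    show ?case using assms(3) by blast
  next
    \<comment> \<open>An edge of \<open>R\<close> prolongs the walk from the current member of
      \<open>X\<close>; an extra edge puts its head into \<open>X\<close>, and the empty walk
      restarts there.\<close>
    case (step y z)
    then show ?case using assms(2) closed by (meson UnE rtrancl.simps subsetD)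
  qed
next
  assume "\<exists>z\<in>X. (z, v) \<in> R\<^sup>*"
  then show "(u, v) \<in> S\<^sup>*"
    using assms(4) rtrancl_mono[OF assms(1)] by (meson rtrancl_trans subsetD)
qed

section \<open>The RAM program: tables, window update and search\<close>

section \<open>The algorithm\<close>

abbreviation (input) "BASE \<equiv> 7 :: nat"
abbreviation (input) "IDX \<equiv> 8 :: nat"
abbreviation (input) "MID \<equiv> 9 :: nat"
abbreviation (input) "KEYS \<equiv> 10 :: nat"
abbreviation (input) "COUNT \<equiv> 11 :: nat"
abbreviation (input) "POS \<equiv> 12 :: nat"
abbreviation (input) "REACH \<equiv> 13 :: nat"
abbreviation (input) "OCC \<equiv> 14 :: nat"
abbreviation (input) "LO \<equiv> 15 :: nat"
abbreviation (input) "HI \<equiv> 16 :: nat"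
abbreviation (input) "KEY \<equiv> 17 :: nat"
abbreviation (input) "WIN \<equiv> 18 :: nat"
abbreviation (input) "HEAD \<equiv> 19 :: nat"
abbreviation (input) "TAIL \<equiv> 20 :: nat"
abbreviation (input) "QUEUE \<equiv> 21 :: nat"
abbreviation (input) "SEEN \<equiv> 22 :: nat"
abbreviation (input) "CUR \<equiv> 23 :: nat"
abbreviation (input) "NEXT \<equiv> 24 :: nat"

abbreviation plus_expr (infixl "+\<^sub>e" 65) where "x +\<^sub>e y \<equiv> Op Add x y"
abbreviation times_expr (infixl "*\<^sub>e" 70) where "x *\<^sub>e y \<equiv> Op Mul x y"
abbreviation div_expr (infixl "'/\<^sub>e" 70) where "x /\<^sub>e y \<equiv> Op Div x y"
abbreviation mod_expr (infixl "%\<^sub>e" 70) where "x %\<^sub>e y \<equiv> Op Mod x y"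
abbreviation less_expr (infix "<\<^sub>e" 50) where "x <\<^sub>e y \<equiv> Op Less x y"
abbreviation eq_expr (infix "=\<^sub>e" 50) where "x =\<^sub>e y \<equiv> Op Eq x y"

abbreviation "NV \<equiv> Read 0 (Const 0)"
abbreviation "NR \<equiv> Read 0 (Const 1)"
abbreviation "Base \<equiv> Var BASE"
abbreviation "Idx \<equiv> Var IDX"

text \<open>Tables of several dimensions are kept in one array by reading the coordinates as digits
  in base \<open>Base\<close>.\<close>

definition at2 :: "expr \<Rightarrow> expr \<Rightarrow> expr" where
  "at2 x y = x *\<^sub>e Base +\<^sub>e y"

definition at4 :: "expr \<Rightarrow> expr \<Rightarrow> expr \<Rightarrow> expr \<Rightarrow> expr" where
  "at4 a b x y = at2 (at2 (at2 a b) x) y"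

lemma cost_at2 [simp]: "cost (at2 x y) = cost x + cost y + 4"
  by (simp add: at2_def)

lemma cost_at4 [simp]: "cost (at4 a b x y) = cost a + cost b + cost x + cost y + 12"
  by (simp add: at4_def)

text \<open>
  A single counter \<open>Idx\<close> runs through all table entries \<open>(a, b, x, y)\<close>. It also meets digit
  combinations that are out of range; the entries written for these do not affect the others.
\<close>

definition "digit_a = Idx /\<^sub>e Base /\<^sub>e Base /\<^sub>e Base"
definition "digit_b = Idx /\<^sub>e Base /\<^sub>e Base %\<^sub>e Base"
definition "digit_x = Idx /\<^sub>e Base %\<^sub>e Base"
definition "digit_y = Idx %\<^sub>e Base"

definition "fill_keys = For IDX (Const 0) NR
  (If (Read 2 Idx <\<^sub>e Const 2)
    (Write KEYS Idx (Read 3 Idx *\<^sub>e NV +\<^sub>e Read 4 Idx))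
    (Write KEYS Idx (NV *\<^sub>e NV)))"

text \<open>The counter is \<open>i * Base + e\<close>, and adding \<open>Base\<close> leads to the
  same key in row \<open>i + 1\<close>. Row 0 relies on the array being 0 initially.\<close>

definition "fill_count = For IDX (Const 0) (NR *\<^sub>e Base)
  (Write COUNT (Idx +\<^sub>e Base)
    (Read COUNT Idx +\<^sub>e (Read KEYS (Idx /\<^sub>e Base) =\<^sub>e Idx %\<^sub>e Base)))"

text \<open>This table locates an arriving request in the prediction in constant time.\<close>

definition "fill_pos = For IDX (Const 0) NR
  (Write POS (at2 (Read KEYS Idx) (Read COUNT (at2 Idx (Read KEYS Idx)))) Idx)"

definition "digit_edge = digit_x *\<^sub>e NV +\<^sub>e digit_y"

abbreviation "All4 \<equiv> Base *\<^sub>e Base *\<^sub>e (Base *\<^sub>e Base)"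

text \<open>Sum and product of bits act as disjunction and conjunction. Equal counts at
  \<open>a\<close> and \<open>b\<close> mean that the edge is not updated between them, and the
  parity decides whether it is present there.\<close>

definition "fill_reach = For IDX (Const 0) All4
  (Write REACH Idx (Const 0 <\<^sub>e (digit_x =\<^sub>e digit_y) +\<^sub>e
    (Read COUNT (at2 digit_a digit_edge) =\<^sub>e Read COUNT (at2 digit_b digit_edge)) *\<^sub>e
    ((Read 1 digit_edge +\<^sub>e Read COUNT (at2 digit_a digit_edge)) %\<^sub>e Const 2)))"

text \<open>Warshall's algorithm in place, for all pairs \<open>(a, b)\<close> at once, with
  \<open>MID\<close> as the intermediate vertex.\<close>

definition "close_reach = For MID (Const 0) NV (For IDX (Const 0) All4
  (If (Read REACH (at4 digit_a digit_b digit_x (Var MID)) *\<^sub>e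
       Read REACH (at4 digit_a digit_b (Var MID) digit_y))
    (Write REACH Idx (Const 1)) Skip))"

text \<open>\<open>OCC\<close> is raised before the test at \<open>LO\<close>, so the arriving
  request may itself release the lower end.\<close>

definition "advance =
  Seq (Write NEXT (Const 0) (Read POS (at2 (Var KEY) (Read OCC (Var KEY))) +\<^sub>e Const 1))
  (Seq (Write OCC (Var KEY) (Read OCC (Var KEY) +\<^sub>e Const 1))
  (Seq (If (Var HI <\<^sub>e Var NEXT) (Write HI (Const 0) (Var NEXT)) Skip)
  (Seq (If (Read COUNT (at2 (Var LO) (Read KEYS (Var LO))) <\<^sub>e Read OCC (Read KEYS (Var LO)))
         (Write LO (Const 0) (Var LO +\<^sub>e Const 1)) Skip)
    (If (Var HI <\<^sub>e Var LO) (Write HI (Const 0) (Var LO)) Skip))))"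

abbreviation "WinKey \<equiv> Read KEYS (Var WIN)"

text \<open>Marks belong to window positions, not to vertices, so each position yields at most one
  queue entry. The key \<open>n * n\<close> stems from a query and is skipped.\<close>

definition "explore = For WIN (Var LO) (Var HI)
  (If (Read SEEN (Var WIN)) Skip
  (If (WinKey <\<^sub>e NV *\<^sub>e NV)
  (If ((Read 1 WinKey +\<^sub>e Read OCC WinKey) %\<^sub>e Const 2)
  (If (Read REACH (at4 (Var LO) (Var HI) (Var CUR) (WinKey /\<^sub>e NV)))
    (Seq (Write SEEN (Var WIN) (Const 1))
    (Seq (Write QUEUE (Var TAIL) (WinKey %\<^sub>e NV))
      (Write TAIL (Const 0) (Var TAIL +\<^sub>e Const 1))))
  Skip) Skip) Skip))"

definition "visit =
  Seq (Write CUR (Const 0) (Read QUEUE (Var HEAD)))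
  (If (Read REACH (at4 (Var LO) (Var HI) (Var CUR) (Read 5 (Const 2)))) (Write 6 (Const 0) (Const 1)) Skip)"

text \<open>Marks are cleared inside the window only, since clearing all of \<open>SEEN\<close>
  would take time depending on the number of requests.\<close>

definition "search =
  Seq (For WIN (Var LO) (Var HI) (Write SEEN (Var WIN) (Const 0)))
  (Seq (Seq (Write QUEUE (Const 0) (Read 5 (Const 1))) (Seq (Write HEAD (Const 0) (Const 0))
    (Seq (Write TAIL (Const 0) (Const 1)) (Write 6 (Const 0) (Const 0)))))
  (While (Var HEAD <\<^sub>e Var TAIL)
    (Seq visit (Seq explore (Write HEAD (Const 0) (Var HEAD +\<^sub>e Const 1))))))"

text \<open>The base exceeds every key (at most \<open>n * n\<close>) and every position and count
  (at most the number of requests).\<close>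

definition "preprocessing =
  Seq (Write BASE (Const 0) (NV *\<^sub>e NV +\<^sub>e NR +\<^sub>e Const 2))
  (Seq fill_keys (Seq fill_count (Seq fill_pos (Seq fill_reach close_reach))))"

definition closure_algorithm :: algorithm where
  "closure_algorithm = \<lparr>preprocess = preprocessing,
     update = Seq (Write KEY (Const 0) (Read 5 (Const 1) *\<^sub>e NV +\<^sub>e Read 5 (Const 2))) advance,
     query = Seq (Seq (Write KEY (Const 0) (NV *\<^sub>e NV)) advance) search\<rparr>"

section \<open>Table addresses within the word size, and correctness of the tables\<close>

section \<open>Preprocessing\<close>

lemma pair_less: "x < A \<Longrightarrow> y < N \<Longrightarrow> x * N + y < A * N" for x y A N :: nat
  using mult_le_mono1[of "Suc x" A N] by simp

lemma pair_eq_iff: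
  fixes N :: nat
  assumes "y < N" "y' < N"
  shows "x * N + y = x' * N + y' \<longleftrightarrow> x = x' \<and> y = y'"
proof -
  have "(x * N + y) div N = x" "(x' * N + y') div N = x'" using assms by simp_all
  then show ?thesis by auto
qed

lemma div_mod_word [simp]: "c < M \<Longrightarrow> c div k mod M = c div k" for c :: nat
  by (meson div_le_dividend le_less_trans mod_less)

lemma mod_mod_word [simp]: "c < M \<Longrightarrow> c mod k mod M = c mod k" for c :: nat
  by (meson mod_less_eq_dividend le_less_trans mod_less)

text \<open>The sum of the two bits can be 2; \<open>2 < 2 ^ w\<close> keeps it from wrapping to
  0.\<close>

lemma eval_or_and:
  assumes "0 < w" "2 < (2::nat) ^ w" "eval w m e1 = of_bool A" "eval w m e2 = of_bool B" "eval w m e3 = of_bool C"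
  shows "eval w m (Const 0 <\<^sub>e e1 +\<^sub>e e2 *\<^sub>e e3) = of_bool (A \<or> B \<and> C)"
  using assms by (cases A; cases B; cases C) auto

text \<open>\<open>ks\<close> abstracts the prediction to its keys, \<open>adj\<close> is the
  initial adjacency matrix and \<open>N\<close> the base of the tables. Addresses of four digits are
  the largest; \<open>word\<close> makes them fit.\<close>

locale prediction =
  fixes w n T :: nat and ks :: "nat list" and adj :: "nat \<Rightarrow> nat" and N :: nat
  assumes len: "length ks = T"
    and keys: "\<And>k. k \<in> set ks \<Longrightarrow> k \<le> n * n"
    and adj: "\<And>e. e < n * n \<Longrightarrow> adj e \<le> 1"
    and N_def: "N = n * n + T + 2"
    and word: "N ^ 4 < 2 ^ w"
begin

definition code :: "nat \<Rightarrow> nat \<Rightarrow> nat \<Rightarrow> nat \<Rightarrow> nat" where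
  "code a b x y = ((a * N + b) * N + x) * N + y"

text \<open>For \<open>a \<le> b\<close>: the edges that the prediction leaves untouched in
  \<open>[a, b)\<close> and that are present there.\<close>

definition core :: "nat \<Rightarrow> nat \<Rightarrow> digraph" where
  "core a b = {(x, y). x < n \<and> y < n \<and> cnt ks a (x * n + y) = cnt ks b (x * n + y) \<and>
     odd (adj (x * n + y) + cnt ks a (x * n + y))}"

lemma key_le: "i < T \<Longrightarrow> ks ! i \<le> n * n"
  using keys len by simp

lemma edge_less: "x < n \<Longrightarrow> y < n \<Longrightarrow> x * n + y < n * n"
  by (rule pair_less)

lemma n_less: "n < N"
proof -
  have "n \<le> n * n" by (cases n) auto
  then show ?thesis unfolding N_def by linarith
qed

lemma T_less: "T < N"
  by (simp add: N_def)

lemma N_powers: "1 < N" "N \<le> N ^ 4" "N * N \<le> N ^ 4"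
proof -
  show "1 < N" by (simp add: N_def)
  then show "N \<le> N ^ 4" "N * N \<le> N ^ 4"
    using power_increasing[of 2 4 N] self_le_power[of N 4] by (auto simp: power2_eq_square)
qed

lemma small:
  "x < N \<Longrightarrow> x < 2 ^ w" "x \<le> N \<Longrightarrow> x < 2 ^ w" "x < N * N \<Longrightarrow> x < 2 ^ w" "x < N ^ 4 \<Longrightarrow> x < 2 ^ w"
  using N_powers word by linarith+

lemma two_less: "2 < (2::nat) ^ w" "Suc 0 < (2::nat) ^ w" "w > 0"
proof -
  have "(2::nat) ^ 4 \<le> N ^ 4" by (intro power_mono) (simp_all add: N_def)
  with word have "(16::nat) < 2 ^ w" by simp
  then show "2 < (2::nat) ^ w" "Suc 0 < (2::nat) ^ w" by simp_all
  then show "w > 0" by (cases w) auto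
qed

lemma code_less:
  assumes "a < N" "b < N" "x < N" "y < N"
  shows "code a b x y < N ^ 4"
proof -
  have "a * N + b < N * N" by (intro pair_less assms)
  then have "(a * N + b) * N + x < N * N * N" by (intro pair_less assms)
  then have "((a * N + b) * N + x) * N + y < N * N * N * N" by (intro pair_less assms)
  then show ?thesis by (simp add: code_def power4_eq_xxxx)
qed

lemma code_digits:
  assumes "b < N" "x < N" "y < N"
  shows "code a b x y mod N = y" "code a b x y div N mod N = x"
    "code a b x y div N div N mod N = b" "code a b x y div N div N div N = a"
  using assms by (simp_all add: code_def)

lemma eval_at2:
  assumes "m BASE 0 = N" "eval w m e1 < N" "eval w m e2 < N"
  shows "eval w m (at2 e1 e2) = eval w m e1 * N + eval w m e2"
  using small(3)[OF pair_less[OF assms(2,3)]] assms(1) by (simp add: at2_def mod_simps)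

text \<open>The reductions modulo \<open>2 ^ w\<close> of intermediate results merge into one at the
  end, so only the final address has to be below \<open>2 ^ w\<close>.\<close>

lemma eval_at4:
  assumes "m BASE 0 = N" "eval w m a < N" "eval w m b < N" "eval w m x < N" "eval w m y < N"
  shows "eval w m (at4 a b x y) = code (eval w m a) (eval w m b) (eval w m x) (eval w m y)"
  using small(4)[OF code_less[OF assms(2-5)]] assms(1)
  by (simp add: at4_def at2_def code_def mod_simps)

lemma eval_digits:
  assumes "m BASE 0 = N" "m IDX 0 = code a b x y" "a < N" "b < N" "x < N" "y < N"
  shows "eval w m digit_a = a" "eval w m digit_b = b" "eval w m digit_x = x" "eval w m digit_y = y"
proof -
  have "code a b x y < 2 ^ w" using small(4) code_less assms by blast
  moreover from this have "code a b x y div N div N < 2 ^ w" "code a b x y div N < 2 ^ w"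
    by (meson div_le_dividend le_less_trans)+
  ultimately show "eval w m digit_a = a" "eval w m digit_b = b" "eval w m digit_x = x" "eval w m digit_y = y"
    unfolding digit_a_def digit_b_def digit_x_def digit_y_def
    using assms code_digits[of b x y a] small(1) by simp_all
qed

definition sizes_ok :: "mem \<Rightarrow> bool" where
  "sizes_ok m \<longleftrightarrow> m 0 0 = n \<and> m 0 1 = T \<and> m BASE 0 = N"

definition keys_ok :: "mem \<Rightarrow> bool" where
  "keys_ok m \<longleftrightarrow> (\<forall>i<T. m KEYS i = ks ! i)"

definition count_ok :: "mem \<Rightarrow> bool" where
  "count_ok m \<longleftrightarrow> (\<forall>i\<le>T. \<forall>e<N. m COUNT (i * N + e) = cnt ks i e)"

definition pos_ok :: "mem \<Rightarrow> bool" where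
  "pos_ok m \<longleftrightarrow> (\<forall>i<T. m POS (ks ! i * N + cnt ks i (ks ! i)) = i)"

definition adj_ok :: "mem \<Rightarrow> bool" where
  "adj_ok m \<longleftrightarrow> (\<forall>e<n * n. m 1 e = adj e)"

definition reach_ok :: "mem \<Rightarrow> bool" where
  "reach_ok m \<longleftrightarrow> (\<forall>a\<le>T. \<forall>b\<le>T. \<forall>x<n. \<forall>y<n. m REACH (code a b x y) = of_bool ((x, y) \<in> (core a b)\<^sup>*))"

lemma runs_fill_keys:
  assumes "sizes_ok m" "\<forall>i<T. ks ! i = (if m 2 i < 2 then m 3 i * n + m 4 i else n * n)"
  shows "runs w fill_keys m (T * 100 + 100) keys_ok"
  unfolding fill_keys_def
proof (rule runs_weaken[OF runs_For[where s = 0 and L = T and B = 50 and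
        I = "\<lambda>i m'. \<forall>j<i. m' KEYS j = ks ! j"]])
  fix i m' assume i: "i < T" "m' IDX 0 = i" and I: "\<forall>j<i. m' KEYS j = ks ! j"
    and ag: "agree_off (insert IDX (writes (If (Read 2 Idx <\<^sub>e Const 2)
      (Write KEYS Idx (Read 3 Idx *\<^sub>e NV +\<^sub>e Read 4 Idx)) (Write KEYS Idx (NV *\<^sub>e NV))))) m m'"
  from ag have same: "m' 0 = m 0" "m' 2 = m 2" "m' 3 = m 3" "m' 4 = m 4" by (auto simp: agree_off_def)
  have "ks ! i < 2 ^ w" using key_le[OF i(1)] by (intro small(1)) (simp add: N_def)
  with i I show "runs w (If (Read 2 Idx <\<^sub>e Const 2)
      (Write KEYS Idx (Read 3 Idx *\<^sub>e NV +\<^sub>e Read 4 Idx)) (Write KEYS Idx (NV *\<^sub>e NV))) m' 50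
      (\<lambda>m'. \<forall>j<Suc i. m' KEYS j = ks ! j)"
    using assms(1) assms(2)[rule_format, OF i(1)] two_less
    by (intro runs_loop_free) (auto simp: same sizes_ok_def store_def less_Suc_eq mod_simps split: if_splits)
qed (use assms(1) two_less small(1)[of T] T_less in \<open>auto simp: sizes_ok_def agree_off_def store_def keys_ok_def\<close>)

text \<open>The invariant is one row ahead of the counter: iteration \<open>c\<close> writes cell
  \<open>c + N\<close>, so before it all cells below \<open>c + N\<close> are correct. At the start
  this claims only row 0.\<close>

lemma runs_fill_count:
  assumes "sizes_ok m" "keys_ok m" "\<forall>i. m COUNT i = 0"
  shows "runs w fill_count m (T * N * 100 + 100) count_ok"
  unfolding fill_count_def
proof (rule runs_weaken[OF runs_For[where s = 0 and L = "T * N" and B = 50 and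
        I = "\<lambda>c m'. \<forall>i\<le>T. \<forall>e<N. i * N + e < c + N \<longrightarrow> m' COUNT (i * N + e) = cnt ks i e"]])
  let ?c = "Write COUNT (Idx +\<^sub>e Base) (Read COUNT Idx +\<^sub>e (Read KEYS (Idx /\<^sub>e Base) =\<^sub>e Idx %\<^sub>e Base))"
  fix c m' assume c: "c < T * N" "m' IDX 0 = c" and ag: "agree_off (insert IDX (writes ?c)) m m'"
    and I: "\<forall>i\<le>T. \<forall>e<N. i * N + e < c + N \<longrightarrow> m' COUNT (i * N + e) = cnt ks i e"
  define i e where "i = c div N" "e = c mod N"
  have ie: "c = i * N + e" "e < N" "i < T"
    using N_powers(1) c(1) by (auto simp: i_e_def less_mult_imp_div_less)
  from ag have same: "m' 0 = m 0" "m' KEYS = m KEYS" "m' BASE = m BASE" by (auto simp: agree_off_def)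
  have "c + N < N * N"
  proof -
    have "c + N < (T + 1) * N" using c by simp
    also have "\<dots> \<le> N * N" by (intro mult_right_mono) (simp_all add: N_def)
    finally show ?thesis .
  qed
  then have bound: "c + N < 2 ^ w" "c < 2 ^ w" using small(3) by fastforce+
  have "m' COUNT c = cnt ks i e" using I ie by simp
  moreover have "cnt ks i e + of_bool (ks ! i = e) < 2 ^ w"
    using cnt_le[of ks i e] ie by (intro small(1)) (simp add: N_def)
  moreover have "i < 2 ^ w" using small(1) T_less ie by simp
  ultimately have "result w ?c m' = store m' COUNT (c + N) (cnt ks (Suc i) e)"
    using assms(1,2) ie bound two_less c(2) cnt_Suc[of i ks e] len
    by (simp add: same sizes_ok_def keys_ok_def mod_simps flip: i_e_def)

  moreover have "m' COUNT (i' * N + e') = cnt ks i' e'"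
    if "i' \<le> T" "e' < N" "i' * N + e' < c + N" for i' e' using I that by blast
  moreover have "i' = Suc i \<and> e' = e" if "e' < N" "i' * N + e' = c + N" for i' e'
    using pair_eq_iff[of e' N e i' "Suc i"] that ie by (simp add: algebra_simps)
  moreover have "i' * N + e' = c + N \<or> i' * N + e' < c + N" if "i' * N + e' < Suc c + N" for i' e'
    using that by linarith
  ultimately show "runs w ?c m' 50
    (\<lambda>m'. \<forall>i\<le>T. \<forall>e<N. i * N + e < Suc c + N \<longrightarrow> m' COUNT (i * N + e) = cnt ks i e)"
    by (intro runs_loop_free) (auto simp: store_def)
next
  show "T * N < 2 ^ w"
    using N_powers T_less by (intro small(3) mult_strict_right_mono) auto
  then show "\<And>m'. agree_off (insert IDX (writes (Write COUNT (Idx +\<^sub>e Base)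
      (Read COUNT Idx +\<^sub>e (Read KEYS (Idx /\<^sub>e Base) =\<^sub>e Idx %\<^sub>e Base))))) m m' \<Longrightarrow>
      eval w m' (NR *\<^sub>e Base) = T * N"
    using assms(1) two_less by (auto simp: agree_off_def sizes_ok_def)
  show "\<forall>i\<le>T. \<forall>e<N. i * N + e < 0 + N \<longrightarrow> m COUNT (i * N + e) = cnt ks i e"
  proof (intro allI impI)
    fix i e assume "i * N + e < 0 + N"
    then have "i = 0" by (cases i) auto
    then show "m COUNT (i * N + e) = cnt ks i e" using assms(3) by simp
  qed
next
  fix m' assume I: "\<forall>i\<le>T. \<forall>e<N. i * N + e < T * N + N \<longrightarrow> m' COUNT (i * N + e) = cnt ks i e"
  have "i * N + e < T * N + N" if "i \<le> T" "e < N" for i e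
    using that pair_less[of i "Suc T" e N] by simp
  then show "count_ok m'" using I by (auto simp: count_ok_def)
qed (auto simp: store_def)

lemma runs_fill_pos:
  assumes "sizes_ok m" "keys_ok m" "count_ok m"
  shows "runs w fill_pos m (T * 100 + 100) pos_ok"
  unfolding fill_pos_def
proof (rule runs_weaken[OF runs_For[where s = 0 and L = T and B = 50 and
        I = "\<lambda>i m'. \<forall>j<i. m' POS (ks ! j * N + cnt ks j (ks ! j)) = j"]])
  let ?c = "Write POS (at2 (Read KEYS Idx) (Read COUNT (at2 Idx (Read KEYS Idx)))) Idx"
  fix i m' assume i: "i < T" "m' IDX 0 = i" and ag: "agree_off (insert IDX (writes ?c)) m m'"
    and I: "\<forall>j<i. m' POS (ks ! j * N + cnt ks j (ks ! j)) = j"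
  from ag have same: "m' KEYS = m KEYS" "m' BASE = m BASE" "m' COUNT = m COUNT" by (auto simp: agree_off_def)
  have b: "ks ! j < N \<and> cnt ks j (ks ! j) < N \<and> j < N" if "j < T" for j
    using cnt_le[of ks j "ks ! j"] that key_le[of j] by (simp add: N_def)
  have "result w ?c m' = store m' POS (ks ! i * N + cnt ks i (ks ! i)) i"
    using assms i b[of i] by (simp add: same eval_at2 sizes_ok_def keys_ok_def count_ok_def)
  \<comment> \<open>By \<open>cnt_inj\<close> the write for \<open>i\<close> does not hit the cell
    of an earlier position.\<close>
  moreover have "ks ! j * N + cnt ks j (ks ! j) \<noteq> ks ! i * N + cnt ks i (ks ! i)" if "j < i" for j
    using cnt_inj[of j ks i] that i len b[of i] b[of j] by (auto simp: pair_eq_iff)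
  ultimately show "runs w ?c m' 50 (\<lambda>m'. \<forall>j<Suc i. m' POS (ks ! j * N + cnt ks j (ks ! j)) = j)"
    using I by (intro runs_loop_free) (auto simp: store_def less_Suc_eq)
qed (use assms(1) two_less small(1)[of T] T_less in \<open>auto simp: sizes_ok_def agree_off_def store_def pos_ok_def\<close>)

lemma eval_edge:
  assumes "m 0 0 = n" "m BASE 0 = N" "m IDX 0 = code a b x y" "a < N" "b < N" "x < n" "y < n"
  shows "eval w m digit_edge = x * n + y"
proof -
  have "x * n + y < 2 ^ w" using edge_less[OF assms(6,7)] by (intro small(1)) (simp add: N_def)
  with eval_digits[of m a b x y] assms n_less show ?thesis by (simp add: digit_edge_def mod_simps)
qed

lemma runs_fill_reach:
  assumes "sizes_ok m" "count_ok m" "adj_ok m"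
  shows "runs w fill_reach m (N ^ 4 * 300 + 300) (\<lambda>m'. \<forall>a\<le>T. \<forall>b\<le>T. \<forall>x<n. \<forall>y<n.
     m' REACH (code a b x y) = of_bool ((x, y) \<in> warshall (core a b) 0))"
proof -
  define c where "c = Write REACH Idx (Const 0 <\<^sub>e (digit_x =\<^sub>e digit_y) +\<^sub>e
    (Read COUNT (at2 digit_a digit_edge) =\<^sub>e Read COUNT (at2 digit_b digit_edge)) *\<^sub>e
    ((Read 1 digit_edge +\<^sub>e Read COUNT (at2 digit_a digit_edge)) %\<^sub>e Const 2))"
  have writes: "writes c = {REACH}" by (simp add: c_def)
  have limit: "time_limit c \<le> 180" "loop_free c"
    by (simp_all add: c_def digit_a_def digit_b_def digit_x_def digit_y_def digit_edge_def)
  show ?thesis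
    unfolding fill_reach_def c_def[symmetric]
  proof (rule runs_weaken[OF runs_For[where s = 0 and L = "N ^ 4" and B = 180 and
          I = "\<lambda>i m'. \<forall>a\<le>T. \<forall>b\<le>T. \<forall>x<n. \<forall>y<n. code a b x y < i \<longrightarrow>
            m' REACH (code a b x y) = of_bool ((x, y) \<in> warshall (core a b) 0)"]])
    fix i m' assume i: "i < N ^ 4" "m' IDX 0 = i" and ag: "agree_off (insert IDX (writes c)) m m'"
      and I: "\<forall>a\<le>T. \<forall>b\<le>T. \<forall>x<n. \<forall>y<n. code a b x y < i \<longrightarrow>
            m' REACH (code a b x y) = of_bool ((x, y) \<in> warshall (core a b) 0)"
    from ag have same: "m' 0 = m 0" "m' (Suc 0) = m (Suc 0)" "m' BASE = m BASE" "m' COUNT = m COUNT"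
      by (auto simp: agree_off_def writes)
    \<comment> \<open>Nothing is claimed about the value \<open>v\<close> stored at a counter with
      digits out of range; the next fact determines \<open>v\<close> for proper codes.\<close>
    obtain v where v: "result w c m' = store m' REACH i v"
      unfolding c_def using i(2) by (simp del: eval.simps(3))
    have "v = of_bool ((x, y) \<in> warshall (core a b) 0)"
      if "a \<le> T" "b \<le> T" "x < n" "y < n" "code a b x y = i" for a b x y
    proof -
      let ?e = "x * n + y"
      have less: "a < N" "b < N" "x < N" "y < N" "?e < n * n" "?e < N"
        using that n_less T_less edge_less[of x y] by (auto simp: N_def)
      have dig: "eval w m' digit_a = a" "eval w m' digit_b = b" "eval w m' digit_x = x"
        "eval w m' digit_y = y" "eval w m' digit_edge = ?e"
        using eval_digits[of m' a b x y] eval_edge[of m' a b x y] less that assms(1) i(2) same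
        by (auto simp: sizes_ok_def)
      have tab: "m COUNT (a * N + ?e) = cnt ks a ?e" "m COUNT (b * N + ?e) = cnt ks b ?e"
        "m (Suc 0) ?e = adj ?e" "m BASE 0 = N"
        using assms that less by (auto simp: sizes_ok_def count_ok_def adj_ok_def)
      have "adj ?e + cnt ks a ?e < 2 ^ w"
        using adj[OF less(5)] cnt_le[of ks a ?e] that by (intro small(2)) (simp add: N_def)
      then have "eval w m' ((Read 1 digit_edge +\<^sub>e Read COUNT (at2 digit_a digit_edge)) %\<^sub>e Const 2)
        = (adj ?e + cnt ks a ?e) mod 2"
        using two_less by (simp add: same dig tab eval_at2 less)
      also have "\<dots> = of_bool (odd (adj ?e + cnt ks a ?e))" by (rule mod_2_eq_odd)
      finally have "eval w m' ((Read 1 digit_edge +\<^sub>e Read COUNT (at2 digit_a digit_edge)) %\<^sub>e Const 2)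
        = of_bool (odd (adj ?e + cnt ks a ?e))" .
      moreover have "eval w m' (digit_x =\<^sub>e digit_y) = of_bool (x = y)"
        "eval w m' (Read COUNT (at2 digit_a digit_edge) =\<^sub>e Read COUNT (at2 digit_b digit_edge))
          = of_bool (cnt ks a ?e = cnt ks b ?e)"
        using two_less by (simp_all add: same dig tab eval_at2 less)
      \<comment> \<open>The condition on the right is membership in the reflexive closure of
        \<open>core a b\<close>, that is, in stage 0.\<close>
      ultimately have "result w c m' REACH i =
          of_bool (x = y \<or> cnt ks a ?e = cnt ks b ?e \<and> odd (adj ?e + cnt ks a ?e))"
        unfolding c_def using i(2) two_less
        by (simp add: store_def eval_or_and del: eval.simps(3))
      then show ?thesis
        using v that by (auto simp: store_def core_def)
    qed
    with I v show "runs w c m' 180 (\<lambda>m'. \<forall>a\<le>T. \<forall>b\<le>T. \<forall>x<n. \<forall>y<n. code a b x y < Suc i \<longrightarrow>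
            m' REACH (code a b x y) = of_bool ((x, y) \<in> warshall (core a b) 0))"
      by (intro runs_loop_free limit) (auto simp: store_def less_Suc_eq)
  next
    fix m' assume "agree_off (insert IDX (writes c)) m m'"
    then show "eval w m' All4 = N ^ 4"
      using assms(1) small(3) word
      by (simp add: agree_off_def writes sizes_ok_def mod_simps power4_eq_xxxx mult.assoc)
  next
    fix m' assume I: "\<forall>a\<le>T. \<forall>b\<le>T. \<forall>x<n. \<forall>y<n. code a b x y < N ^ 4 \<longrightarrow>
            m' REACH (code a b x y) = of_bool ((x, y) \<in> warshall (core a b) 0)"
    then show "\<forall>a\<le>T. \<forall>b\<le>T. \<forall>x<n. \<forall>y<n.
            m' REACH (code a b x y) = of_bool ((x, y) \<in> warshall (core a b) 0)"
      using code_less n_less T_less by simp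
  qed (auto simp: store_def word writes)
qed

text \<open>
  The table is closed in place, so during stage \<open>k\<close> an entry may already be ahead of that stage;
  bounding it from both sides avoids describing its exact value.
\<close>

definition reach_between :: "nat \<Rightarrow> nat \<Rightarrow> mem \<Rightarrow> bool" where
  "reach_between k c m \<longleftrightarrow> (\<forall>a\<le>T. \<forall>b\<le>T. \<forall>x<n. \<forall>y<n. \<exists>P. m REACH (code a b x y) = of_bool P \<and>
     (P \<longrightarrow> (x, y) \<in> (core a b)\<^sup>*) \<and> ((x, y) \<in> warshall (core a b) k \<longrightarrow> P) \<and>
     (code a b x y < c \<longrightarrow> (x, y) \<in> warshall (core a b) (Suc k) \<longrightarrow> P))"

lemma reach_between_0:
  assumes "\<forall>a\<le>T. \<forall>b\<le>T. \<forall>x<n. \<forall>y<n. m REACH (code a b x y) = of_bool ((x, y) \<in> warshall (core a b) 0)"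
  shows "reach_between 0 0 m"
  unfolding reach_between_def
proof (intro allI impI exI conjI)
  fix a b x y assume *: "a \<le> T" "b \<le> T" "x < n" "y < n"
  show "m REACH (code a b x y) = of_bool ((x, y) \<in> warshall (core a b) 0)" using assms * by blast
qed (use warshall_sound in \<open>blast+\<close>)

text \<open>All proper codes lie below \<open>N ^ 4\<close>, so after a full pass the third clause
  becomes the lower bound of the next stage, whose own third clause is vacuous.\<close>

lemma reach_between_next: "reach_between k (N ^ 4) m \<Longrightarrow> reach_between (Suc k) 0 m"
  unfolding reach_between_def
proof (intro allI impI)
  fix a b x y
  assume I: "\<forall>a\<le>T. \<forall>b\<le>T. \<forall>x<n. \<forall>y<n. \<exists>P. m REACH (code a b x y) = of_bool P \<and>
     (P \<longrightarrow> (x, y) \<in> (core a b)\<^sup>*) \<and> ((x, y) \<in> warshall (core a b) k \<longrightarrow> P) \<and>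
     (code a b x y < N ^ 4 \<longrightarrow> (x, y) \<in> warshall (core a b) (Suc k) \<longrightarrow> P)"
    and *: "a \<le> T" "b \<le> T" "x < n" "y < n"
  have "code a b x y < N ^ 4" using * n_less T_less by (intro code_less) auto
  with I[rule_format, OF *] show "\<exists>P. m REACH (code a b x y) = of_bool P \<and>
     (P \<longrightarrow> (x, y) \<in> (core a b)\<^sup>*) \<and> ((x, y) \<in> warshall (core a b) (Suc k) \<longrightarrow> P) \<and>
     (code a b x y < 0 \<longrightarrow> (x, y) \<in> warshall (core a b) (Suc (Suc k)) \<longrightarrow> P)"
    by blast
qed

text \<open>After \<open>n\<close> stages the lower bound meets the upper one, because
  \<open>core a b\<close> has edges only between vertices below \<open>n\<close>.\<close>

lemma reach_between_end:
  assumes "reach_between n 0 m"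
  shows "reach_ok m"
  unfolding reach_ok_def
proof (intro allI impI)
  fix a b x y assume *: "a \<le> T" "b \<le> T" "x < n" "y < n"
  have "core a b \<subseteq> {..<n} \<times> {..<n}" by (auto simp: core_def)
  then have "warshall (core a b) n = (core a b)\<^sup>*" by (rule warshall_complete)
  moreover from assms * obtain P where "m REACH (code a b x y) = of_bool P"
    "P \<longrightarrow> (x, y) \<in> (core a b)\<^sup>*" "(x, y) \<in> warshall (core a b) n \<longrightarrow> P"
    unfolding reach_between_def by blast
  ultimately show "m REACH (code a b x y) = of_bool ((x, y) \<in> (core a b)\<^sup>*)" by auto
qed

lemma runs_close_reach:
  assumes "sizes_ok m" "reach_between 0 0 m"
  shows "runs w close_reach m (n * (N ^ 4 * 300 + 400) + 200) reach_ok"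
proof -
  define c where "c = If (Read REACH (at4 digit_a digit_b digit_x (Var MID)) *\<^sub>e
       Read REACH (at4 digit_a digit_b (Var MID) digit_y))
    (Write REACH Idx (Const 1)) Skip"
  have writes: "writes c = {REACH}" by (simp add: c_def)
  have limit: "time_limit c \<le> 180" "loop_free c"
    by (simp_all add: c_def digit_a_def digit_b_def digit_x_def digit_y_def)
  have inner: "runs w (For IDX (Const 0) All4 c) m1 (N ^ 4 * 300 + 300) (reach_between (Suc k) 0)"
    if m1: "sizes_ok m1" "m1 MID 0 = k" "k < n" "reach_between k 0 m1" for k m1
  proof (rule runs_weaken[OF runs_For[where s = 0 and L = "N ^ 4" and B = 180 and I = "reach_between k"]])
    fix i m' assume i: "i < N ^ 4" "m' IDX 0 = i" and ag: "agree_off (insert IDX (writes c)) m1 m'"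
      and I: "reach_between k i m'"
    from ag have same: "m' MID = m1 MID" "m' BASE = m1 BASE" by (auto simp: agree_off_def writes)
    have "reach_between k (Suc i) (result w c m')"
      unfolding reach_between_def
    proof (intro allI impI)
      fix a b x y assume *: "a \<le> T" "b \<le> T" "x < n" "y < n"
      let ?Q = "\<lambda>c m P. m REACH (code a b x y) = of_bool P \<and>
         (P \<longrightarrow> (x, y) \<in> (core a b)\<^sup>*) \<and> ((x, y) \<in> warshall (core a b) k \<longrightarrow> P) \<and>
         (code a b x y < c \<longrightarrow> (x, y) \<in> warshall (core a b) (Suc k) \<longrightarrow> P)"
      from I * obtain P where P: "?Q i m' P" unfolding reach_between_def by blast
      show "\<exists>P. ?Q (Suc i) (result w c m') P"
      proof (cases "code a b x y = i")
        case False
        then have "result w c m' REACH (code a b x y) = m' REACH (code a b x y)"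
          using i(2) by (auto simp: c_def store_def)
        with P False show ?thesis by (metis less_Suc_eq)
      next
        case True
        have less: "a < N" "b < N" "x < N" "y < N" "k < N"
          using * n_less T_less m1(3) by auto
        have dig: "eval w m' digit_a = a" "eval w m' digit_b = b" "eval w m' digit_x = x"
          "eval w m' digit_y = y"
          using eval_digits[of m' a b x y] less True m1(1) i(2) same by (auto simp: sizes_ok_def)
        \<comment> \<open>The entries at \<open>(x, k)\<close> and \<open>(k, y)\<close> may already
          have been improved in this pass; soundness and the stage \<open>k\<close> lower bound
          suffice for both.\<close>
        from I * m1(3) obtain P1 where P1: "m' REACH (code a b x k) = of_bool P1"
          "P1 \<longrightarrow> (x, k) \<in> (core a b)\<^sup>*" "(x, k) \<in> warshall (core a b) k \<longrightarrow> P1"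
          unfolding reach_between_def by blast
        from I * m1(3) obtain P2 where P2: "m' REACH (code a b k y) = of_bool P2"
          "P2 \<longrightarrow> (k, y) \<in> (core a b)\<^sup>*" "(k, y) \<in> warshall (core a b) k \<longrightarrow> P2"
          unfolding reach_between_def by blast
        have base: "m' BASE 0 = N" "m' MID 0 = k" using same m1 by (auto simp: sizes_ok_def)
        have "result w c m' = (if P1 \<and> P2 then store m' REACH i 1 else m')"
          using two_less by (simp add: c_def eval_at4 base dig less P1(1) P2(1) i(2))
        then have "?Q (Suc i) (result w c m') (P \<or> P1 \<and> P2)"
          using P P1(2,3) P2(2,3) True by (auto simp: store_def intro: rtrancl_trans)
        then show ?thesis by blast
      qed
    qed
    then show "runs w c m' 180 (reach_between k (Suc i))"
      by (intro runs_loop_free limit)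
  next
    fix m' assume "agree_off (insert IDX (writes c)) m1 m'"
    then show "eval w m' All4 = N ^ 4"
      using m1(1) word
      by (simp add: agree_off_def writes sizes_ok_def mod_simps power4_eq_xxxx mult.assoc)
  next
    show "reach_between k 0 m1" by (rule m1)
    show "reach_between (Suc k) 0 m'" if "reach_between k (N ^ 4) m'" for m'
      using that by (rule reach_between_next)
    show "reach_between k i (store m' IDX 0 z)" if "reach_between k i m'" for i m' z
      using that by (simp add: reach_between_def store_def)
  qed (auto simp: word writes)
  show ?thesis
    unfolding close_reach_def c_def[symmetric]
  proof (rule runs_weaken[OF runs_For[where s = 0 and L = n and B = "N ^ 4 * 300 + 300" and
          I = "\<lambda>k. reach_between k 0"]])
    fix i m' assume i: "i < n" "m' MID 0 = i" "reach_between i 0 m'"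
      and "agree_off (insert MID (writes (For IDX (Const 0) All4 c))) m m'"
    then have "sizes_ok m'" using assms(1) by (auto simp: sizes_ok_def agree_off_def writes)
    with i show "runs w (For IDX (Const 0) All4 c) m' (N ^ 4 * 300 + 300) (reach_between (Suc i) 0)"
      using inner by blast
  next
    show "reach_between k i (store m' MID 0 z)" if "reach_between k i m'" for k i m' z
      using that by (simp add: reach_between_def store_def)
  qed (use assms n_less small(1)[of n] reach_between_end in
      \<open>auto simp: writes sizes_ok_def agree_off_def algebra_simps\<close>)
qed


end

lemma writes_preprocessing:
  "writes fill_keys = {IDX, KEYS}" "writes fill_count = {IDX, COUNT}" "writes fill_pos = {IDX, POS}"
  "writes fill_reach = {IDX, REACH}" "writes close_reach = {MID, IDX, REACH}"
  "writes preprocessing = {BASE, IDX, MID, KEYS, COUNT, POS, REACH}"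
  by (auto simp: fill_keys_def fill_count_def fill_pos_def fill_reach_def close_reach_def preprocessing_def)

text \<open>Lets a conditional assignment be treated as an unconditional one that may store the old
  value.\<close>

lemma store_triv: "m k i = x \<Longrightarrow> store m k i x = m"
  by (auto simp: store_def)

context prediction
begin

definition tables_ok :: "mem \<Rightarrow> bool" where
  "tables_ok m \<longleftrightarrow> sizes_ok m \<and> keys_ok m \<and> count_ok m \<and> pos_ok m \<and> adj_ok m \<and> reach_ok m"

lemma ok_agree:
  assumes "agree_off K m m'"
  shows "sizes_ok m \<Longrightarrow> 0 \<notin> K \<Longrightarrow> BASE \<notin> K \<Longrightarrow> sizes_ok m'"
    "keys_ok m \<Longrightarrow> KEYS \<notin> K \<Longrightarrow> keys_ok m'"
    "count_ok m \<Longrightarrow> COUNT \<notin> K \<Longrightarrow> count_ok m'"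
    "pos_ok m \<Longrightarrow> POS \<notin> K \<Longrightarrow> pos_ok m'"
    "adj_ok m \<Longrightarrow> 1 \<notin> K \<Longrightarrow> adj_ok m'"
    "reach_ok m \<Longrightarrow> REACH \<notin> K \<Longrightarrow> reach_ok m'"
  using assms
  by (auto simp: agree_off_def sizes_ok_def keys_ok_def count_ok_def pos_ok_def adj_ok_def reach_ok_def)

lemma runs_preprocessing:
  assumes "m 0 0 = n" "m 0 1 = T" "adj_ok m" "\<forall>i. m COUNT i = 0"
    "\<forall>i<T. ks ! i = (if m 2 i < 2 then m 3 i * n + m 4 i else n * n)"
  shows "runs w preprocessing m (3000 * N ^ 5) tables_ok"
proof -
  let ?B = "20 + ((T * 100 + 100) + ((T * N * 100 + 100) + ((T * 100 + 100) +
    ((N ^ 4 * 300 + 300) + (n * (N ^ 4 * 300 + 400) + 200)))))"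
  have "runs w preprocessing m ?B tables_ok"
    unfolding preprocessing_def
  proof (rule runs_Seq)
    have "N < 2 ^ w" using small(2) by simp
    then have "(n * n + T + 2) mod 2 ^ w = N" by (simp add: N_def)
    then show "runs w (Write BASE (Const 0) (NV *\<^sub>e NV +\<^sub>e NR +\<^sub>e Const 2)) m 20 sizes_ok"
      using assms two_less
      by (intro runs_loop_free) (auto simp: sizes_ok_def store_def mod_simps)
    fix m1 assume 1: "agree_off (writes (Write BASE (Const 0) (NV *\<^sub>e NV +\<^sub>e NR +\<^sub>e Const 2))) m m1" "sizes_ok m1"
    \<comment> \<open>Each of the lists \<open>k1\<close> to \<open>k6\<close> transports invariants
      past one phase, which leaves the arrays concerned alone.\<close>
    note k1 = 1(2) ok_agree[OF 1(1)]
    show "runs w (Seq fill_keys (Seq fill_count (Seq fill_pos (Seq fill_reach close_reach)))) m1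
      ((T * 100 + 100) + ((T * N * 100 + 100) + ((T * 100 + 100) +
      ((N ^ 4 * 300 + 300) + (n * (N ^ 4 * 300 + 400) + 200))))) tables_ok"
    proof (rule runs_Seq)
      show "runs w fill_keys m1 (T * 100 + 100) keys_ok"
        using assms 1 by (intro runs_fill_keys) (auto simp: agree_off_def)
      fix m2 assume 2: "agree_off (writes fill_keys) m1 m2" "keys_ok m2"
      note k2 = 2(2) ok_agree[OF 2(1)]
      have c2: "\<forall>i. m2 COUNT i = 0" using assms 1 2 by (auto simp: agree_off_def writes_preprocessing)
      show "runs w (Seq fill_count (Seq fill_pos (Seq fill_reach close_reach))) m2
        ((T * N * 100 + 100) + ((T * 100 + 100) +
        ((N ^ 4 * 300 + 300) + (n * (N ^ 4 * 300 + 400) + 200)))) tables_ok"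
      proof (rule runs_Seq)
        show "runs w fill_count m2 (T * N * 100 + 100) count_ok"
          using k1 k2 c2 by (intro runs_fill_count) (auto simp: writes_preprocessing)
        fix m3 assume 3: "agree_off (writes fill_count) m2 m3" "count_ok m3"
        note k3 = 3(2) ok_agree[OF 3(1)]
        show "runs w (Seq fill_pos (Seq fill_reach close_reach)) m3
          ((T * 100 + 100) + ((N ^ 4 * 300 + 300) + (n * (N ^ 4 * 300 + 400) + 200))) tables_ok"
        proof (rule runs_Seq)
          show "runs w fill_pos m3 (T * 100 + 100) pos_ok"
            using k1 k2 k3 by (intro runs_fill_pos) (auto simp: writes_preprocessing)
          fix m4 assume 4: "agree_off (writes fill_pos) m3 m4" "pos_ok m4"
          note k4 = 4(2) ok_agree[OF 4(1)]
          show "runs w (Seq fill_reach close_reach) m4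
            ((N ^ 4 * 300 + 300) + (n * (N ^ 4 * 300 + 400) + 200)) tables_ok"
          proof (rule runs_Seq)
            show "runs w fill_reach m4 (N ^ 4 * 300 + 300) (\<lambda>m'. \<forall>a\<le>T. \<forall>b\<le>T. \<forall>x<n. \<forall>y<n.
                m' REACH (code a b x y) = of_bool ((x, y) \<in> warshall (core a b) 0))"
              using k1 k2 k3 k4 assms(3) by (intro runs_fill_reach) (auto simp: writes_preprocessing)
            fix m5 assume 5: "agree_off (writes fill_reach) m4 m5" "\<forall>a\<le>T. \<forall>b\<le>T. \<forall>x<n. \<forall>y<n.
                m5 REACH (code a b x y) = of_bool ((x, y) \<in> warshall (core a b) 0)"
            note k5 = ok_agree[OF 5(1)]
            have "sizes_ok m5" using k1 k2 k3 k4 k5 by (auto simp: writes_preprocessing)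
            then have "runs w close_reach m5 (n * (N ^ 4 * 300 + 400) + 200) reach_ok"
              using reach_between_0[of m5] 5(2) by (intro runs_close_reach) auto
            then show "runs w close_reach m5 (n * (N ^ 4 * 300 + 400) + 200) tables_ok"
            proof (rule runs_weaken)
              fix m6 assume 6: "agree_off (writes close_reach) m5 m6" "reach_ok m6"
              note k6 = 6(2) ok_agree[OF 6(1)]
              show "tables_ok m6"
                using assms(3) k1 k2 k3 k4 k5 k6 by (auto simp: writes_preprocessing tables_ok_def)
            qed simp
          qed
        qed
      qed
    qed
  qed
  then show ?thesis
  proof (rule runs_weaken)
    \<comment> \<open>The closing loop dominates with \<open>n * N ^ 4\<close> inner iterations;
      every other term is at most a constant multiple of \<open>N ^ 4\<close>.\<close>
    have N5: "N ^ 5 = N * N ^ 4" by (simp add: eval_nat_numeral)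
    have "1 \<le> N" "1 \<le> N ^ 4" using N_powers by simp_all
    have "N ^ 4 \<le> N ^ 5" "n * N ^ 4 \<le> N ^ 5"
      using n_less N_powers(1) unfolding N5 by auto
    moreover have "T \<le> N ^ 4" "1 \<le> N ^ 4" "n \<le> N ^ 4" "T * N \<le> N ^ 4"
      using T_less n_less N_powers order_trans[OF mult_right_mono[of T N N] N_powers(3)] by auto
    ultimately show "?B \<le> 3000 * N ^ 5" by (simp add: algebra_simps)
  qed
qed

end

section \<open>The window invariant and its update by one request\<close>

section \<open>Maintaining the window\<close>

locale window = prediction +
  fixes occ :: "nat \<Rightarrow> nat" and a b :: nat
  assumes window: "a \<le> b" "b \<le> T"
    and occ: "\<And>e. e \<le> n * n \<Longrightarrow> cnt ks a e \<le> occ e \<and> occ e \<le> cnt ks b e"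

context prediction
begin

definition state_ok :: "(nat \<Rightarrow> nat) \<Rightarrow> nat \<Rightarrow> nat \<Rightarrow> mem \<Rightarrow> bool" where
  "state_ok occ a b m \<longleftrightarrow> tables_ok m \<and> m LO 0 = a \<and> m HI 0 = b \<and> (\<forall>e\<le>n * n. m OCC e = occ e)"

lemma state_ok_agree:
  assumes "state_ok occ a b m" "agree_off K m m'" "K \<inter> {0, 1, BASE, KEYS, COUNT, POS, REACH, OCC, LO, HI} = {}"
  shows "state_ok occ a b m'"
  using assms(1,3) ok_agree[OF assms(2)] agree_offD[OF assms(2)]
  by (auto simp: state_ok_def tables_ok_def)

text \<open>The lower end passes only an occurrence that has already arrived, and the upper end is
  raised past the predicted position \<open>p\<close> of the arriving occurrence. Both moves keep
  \<open>occ\<close> between the counts at the two ends.\<close>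

lemma runs_advance:
  assumes win: "window w n T ks adj N occ a b" and st: "state_ok occ a b m" and "a < T"
    and k: "m KEY 0 = k" "k \<le> n * n" and p: "p < T" "ks ! p = k" "cnt ks p k = occ k"
  defines "occ' \<equiv> occ(k := Suc (occ k))"
  defines "a' \<equiv> (if cnt ks a (ks ! a) < occ' (ks ! a) then Suc a else a)"
  defines "b' \<equiv> max (max b (Suc p)) a'"
  shows "window w n T ks adj N occ' a' b'" "runs w advance m 100 (state_ok occ' a' b')"
proof -
  interpret window w n T ks adj N occ a b by (rule win)
  have cnt_p: "cnt ks (Suc p) k = Suc (occ k)" using p len by (simp add: cnt_Suc)
  show "window w n T ks adj N occ' a' b'"
  proof
    show "a' \<le> b'" by (simp add: b'_def)
    show "b' \<le> T" using window \<open>a < T\<close> p by (simp add: b'_def a'_def)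
    fix e assume e: "e \<le> n * n"
    have "cnt ks a e \<le> occ' e" using occ[OF e] by (auto simp: occ'_def)
    then have "cnt ks a' e \<le> occ' e" using \<open>a < T\<close> len by (simp add: a'_def cnt_Suc)
    moreover have *: "b \<le> b'" "Suc p \<le> b'" by (simp_all add: b'_def)
    have "occ' e \<le> cnt ks b' e"
    proof (cases "e = k")
      case True
      with * show ?thesis using cnt_mono[of "Suc p" b' ks k] cnt_p by (simp add: occ'_def)
    next
      case False
      with * show ?thesis using cnt_mono[of b b' ks e] occ[OF e] by (simp add: occ'_def)
    qed
    ultimately show "cnt ks a' e \<le> occ' e \<and> occ' e \<le> cnt ks b' e" ..
  qed
  have tab: "tables_ok m" "m LO 0 = a" "m HI 0 = b" "m OCC k = occ k" "m OCC (ks ! a) = occ (ks ! a)"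
    using st k key_le[OF \<open>a < T\<close>] by (auto simp: state_ok_def)
  have "occ k < N"
    using p cnt_le[of ks p k] T_less by simp
  have less: "k < N" "a < N" "ks ! a < N" "cnt ks a (ks ! a) < N" "Suc p < 2 ^ w" "Suc (occ k) < 2 ^ w"
    "Suc a < 2 ^ w"
    using k(2) key_le[OF \<open>a < T\<close>] cnt_le[of ks a "ks ! a"] \<open>a < T\<close> p T_less \<open>occ k < N\<close>
    by (auto intro!: small(2) simp: N_def)
  have rd: "m BASE 0 = N" "m POS (k * N + occ k) = p" "m KEYS a = ks ! a"
    "m COUNT (a * N + ks ! a) = cnt ks a (ks ! a)"
    using tab(1) p less \<open>a < T\<close>
    by (auto simp: tables_ok_def sizes_ok_def pos_ok_def keys_ok_def count_ok_def)
  let ?r = "result w advance m"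
  \<comment> \<open>\<open>m1\<close> to \<open>m4\<close> are the memories between the five
    statements of \<open>advance\<close>; a skipped conditional counts as writing the old
    value.\<close>
  define m1 where "m1 = store m NEXT 0 (Suc p)"
  define m2 where "m2 = store m1 OCC k (Suc (occ k))"
  define m3 where "m3 = store m2 HI 0 (max b (Suc p))"
  define m4 where "m4 = store m3 LO 0 a'"
  have 1: "result w (Write NEXT (Const 0) (Read POS (at2 (Var KEY) (Read OCC (Var KEY))) +\<^sub>e Const 1)) m = m1"
    using two_less less \<open>occ k < N\<close> by (simp add: eval_at2 k tab rd m1_def mod_simps)
  have 2: "result w (Write OCC (Var KEY) (Read OCC (Var KEY) +\<^sub>e Const 1)) m1 = m2"
    using two_less less by (simp add: k tab m1_def m2_def store_def mod_simps)
  have "m2 HI 0 = b" "m2 NEXT 0 = Suc p" by (simp_all add: m2_def m1_def store_def tab)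
  then have 3: "result w (If (Var HI <\<^sub>e Var NEXT) (Write HI (Const 0) (Var NEXT)) Skip) m2 = m3"
    using two_less by (auto simp: m3_def store_triv max_def)
  have "m3 LO 0 = a" "m3 BASE 0 = N" "m3 KEYS a = ks ! a" "m3 OCC (ks ! a) = occ' (ks ! a)"
    "m3 COUNT (a * N + ks ! a) = cnt ks a (ks ! a)"
    by (simp_all add: m3_def m2_def m1_def store_def tab rd occ'_def)
  then have 4: "result w (If (Read COUNT (at2 (Var LO) (Read KEYS (Var LO))) <\<^sub>e Read OCC (Read KEYS (Var LO)))
      (Write LO (Const 0) (Var LO +\<^sub>e Const 1)) Skip) m3 = m4"
    using two_less less by (simp add: eval_at2 m4_def a'_def store_triv mod_simps)
  have "m4 HI 0 = max b (Suc p)" "m4 LO 0 = a'" by (simp_all add: m4_def m3_def store_def)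
  then have 5: "result w (If (Var HI <\<^sub>e Var LO) (Write HI (Const 0) (Var LO)) Skip) m4 = store m4 HI 0 b'"
    using two_less by (auto simp: b'_def store_triv max_def)
  have "?r = store m4 HI 0 b'"
    unfolding advance_def using 1 2 3 4 5 by (simp only: result.simps(2))
  then have r: "?r LO 0 = a'" "?r HI 0 = b'" "?r OCC = (m OCC)(k := Suc (occ k))"
    and "agree_off {NEXT, OCC, HI, LO} m ?r"
    by (simp_all add: m4_def m3_def m2_def m1_def store_def agree_off_def)
  from ok_agree[OF this(4)] tab(1) have "tables_ok ?r" by (auto simp: tables_ok_def)
  with r st have "state_ok occ' a' b' ?r"
    by (auto simp: state_ok_def occ'_def)
  moreover have "loop_free advance" "time_limit advance \<le> 100" by (simp_all add: advance_def)
  ultimately show "runs w advance m 100 (state_ok occ' a' b')"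
    by (intro runs_loop_free)
qed

end

section \<open>Search in the current graph by way of the window\<close>

section \<open>Answering a query\<close>

context window
begin

definition graph :: digraph where
  "graph = {(x, y). x < n \<and> y < n \<and> odd (adj (x * n + y) + occ (x * n + y))}"

text \<open>Positions instead of edges, in line with the marks in \<open>SEEN\<close>; an edge
  updated repeatedly in the window is listed once per occurrence.\<close>

definition extra :: "nat set" where
  "extra = {i. a \<le> i \<and> i < b \<and> ks ! i < n * n \<and> odd (adj (ks ! i) + occ (ks ! i))}"

text \<open>\<open>S\<close> holds the marked positions; the equation for \<open>q\<close> records
  that each mark came with exactly one queue entry besides \<open>u\<close>.\<close>

definition queue_ok :: "nat \<Rightarrow> nat set \<Rightarrow> (nat \<Rightarrow> nat) \<Rightarrow> nat \<Rightarrow> bool" where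
  "queue_ok u S Q q \<longleftrightarrow> S \<subseteq> {a..<b} \<and> q = Suc (card S) \<and> Q 0 = u \<and>
     (\<forall>j<q. Q j < n \<and> (u, Q j) \<in> graph\<^sup>*) \<and> (\<forall>i\<in>S. \<exists>j<q. Q j = ks ! i mod n)"

definition explored :: "nat set \<Rightarrow> (nat \<Rightarrow> nat) \<Rightarrow> nat \<Rightarrow> bool" where
  "explored S Q h \<longleftrightarrow> (\<forall>j<h. \<forall>i\<in>extra. (Q j, ks ! i div n) \<in> (core a b)\<^sup>* \<longrightarrow> i \<in> S)"

lemma edge_div_mod: "e < n * n \<Longrightarrow> e div n < n \<and> e mod n < n \<and> e div n * n + e mod n = e"
  by (cases "n = 0") (auto simp: less_mult_imp_div_less)

text \<open>Equal counts at both ends force \<open>occ\<close> to the same value, so the parity at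
  \<open>a\<close> is the current one.\<close>

lemma core_subset: "core a b \<subseteq> graph"
proof clarify
  fix x y assume xy: "(x, y) \<in> core a b"
  then have "x * n + y \<le> n * n" using edge_less[of x y] by (auto simp: core_def)
  from occ[OF this] xy show "(x, y) \<in> graph" by (auto simp: core_def graph_def)
qed

lemma extra_edge: "i \<in> extra \<Longrightarrow> (ks ! i div n, ks ! i mod n) \<in> graph"
  using edge_div_mod[of "ks ! i"] by (auto simp: extra_def graph_def)

text \<open>If the counts of a present edge at \<open>a\<close> and \<open>b\<close> differ, it
  occurs in the window and is extra; otherwise it lies in \<open>core a b\<close>.\<close>

lemma graph_subset: "graph \<subseteq> core a b \<union> {(ks ! i div n, ks ! i mod n) | i. i \<in> extra}"
proof (rule subrelI, rule UnCI)
  fix x y assume xy: "(x, y) \<in> graph" and no: "(x, y) \<notin> {(ks ! i div n, ks ! i mod n) | i. i \<in> extra}"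
  from xy have less: "x < n" "y < n" "x * n + y < n * n" and odd: "odd (adj (x * n + y) + occ (x * n + y))"
    using edge_less[of x y] by (auto simp: graph_def)
  have "cnt ks a (x * n + y) = cnt ks b (x * n + y)"
  proof (rule ccontr)
    assume "cnt ks a (x * n + y) \<noteq> cnt ks b (x * n + y)"
    then obtain i where i: "a \<le> i" "i < b" "ks ! i = x * n + y"
      using cnt_neq_imp_between[of ks a "x * n + y" b] window len by auto
    then have "i \<in> extra" using less odd by (simp add: extra_def)
    moreover have "(x, y) = (ks ! i div n, ks ! i mod n)" using i less by simp
    ultimately show False using no by blast
  qed
  with occ[of "x * n + y"] less odd show "(x, y) \<in> core a b" by (auto simp: core_def)
qed

lemma queue_ok_push:
  assumes q: "queue_ok u S Q q" and i: "i \<in> extra" "i \<notin> S" and j: "j < q" "(Q j, ks ! i div n) \<in> (core a b)\<^sup>*"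
  shows "queue_ok u (insert i S) (Q(q := ks ! i mod n)) (Suc q)"
proof -
  have "finite S" using q finite_subset by (auto simp: queue_ok_def)
  have "(u, Q j) \<in> graph\<^sup>*" using q j by (auto simp: queue_ok_def)
  also have "(Q j, ks ! i div n) \<in> graph\<^sup>*" using j rtrancl_mono[OF core_subset] by blast
  also have "(ks ! i div n, ks ! i mod n) \<in> graph" using i by (intro extra_edge)
  finally have "(u, ks ! i mod n) \<in> graph\<^sup>*" .
  moreover have "ks ! i mod n < n" "i \<in> {a..<b}" using i(1) edge_div_mod by (auto simp: extra_def)
  moreover have "\<exists>j<Suc q. (Q(q := ks ! i mod n)) j = ks ! i' mod n" if i': "i' \<in> insert i S" for i'
  proof (cases "i' = i")
    case False
    with i' q obtain j where "j < q" "Q j = ks ! i' mod n" by (auto simp: queue_ok_def)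
    then show ?thesis by (intro exI[of _ j]) auto
  qed auto
  ultimately show ?thesis
    using q i(2) \<open>finite S\<close> unfolding queue_ok_def by (intro conjI ballI) (auto simp: less_Suc_eq)
qed

lemma explored_push:
  "explored S Q h \<Longrightarrow> h \<le> q \<Longrightarrow> explored (insert i S) (Q(q := y)) h"
  by (auto simp: explored_def)

text \<open>The queue entries form the set \<open>X\<close> of
  \<open>rtrancl_via_extra_edges\<close>, and \<open>explored\<close> up to \<open>q\<close> is its
  closure condition.\<close>

lemma reachable_iff_queue:
  assumes q: "queue_ok u S Q q" and e: "explored S Q q"
  shows "(u, v) \<in> graph\<^sup>* \<longleftrightarrow> (\<exists>j<q. (Q j, v) \<in> (core a b)\<^sup>*)"
proof -
  have "(u, v) \<in> graph\<^sup>* \<longleftrightarrow> (\<exists>z\<in>Q ` {..<q}. (z, v) \<in> (core a b)\<^sup>*)"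
  proof (rule rtrancl_via_extra_edges[OF core_subset graph_subset])
    show "u \<in> Q ` {..<q}" using q by (force simp: queue_ok_def)
    show "(u, z) \<in> graph\<^sup>*" if "z \<in> Q ` {..<q}" for z
      using q that by (auto simp: queue_ok_def)
    fix z x y assume "z \<in> Q ` {..<q}" "(z, x) \<in> (core a b)\<^sup>*"
      and "(x, y) \<in> {(ks ! i div n, ks ! i mod n) | i. i \<in> extra}"
    then obtain i where "i \<in> S" "y = ks ! i mod n" using e by (auto simp: explored_def)
    then show "y \<in> Q ` {..<q}" using q by (force simp: queue_ok_def)
  qed
  then show ?thesis by auto
qed

definition seen :: "mem \<Rightarrow> nat set" where
  "seen m = {i. a \<le> i \<and> i < b \<and> m SEEN i \<noteq> 0}"

text \<open>\<open>h\<close> entries have been explored and \<open>g\<close> compared with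
  \<open>v\<close>; the two numbers differ by one between \<open>visit\<close> and the end of
  \<open>explore\<close>.\<close>

definition search_ok :: "nat \<Rightarrow> nat \<Rightarrow> nat \<Rightarrow> nat \<Rightarrow> mem \<Rightarrow> bool" where
  "search_ok u v h g m \<longleftrightarrow> state_ok occ a b m \<and> m 5 1 = u \<and> m 5 2 = v \<and> m HEAD 0 = h \<and> h \<le> m TAIL 0 \<and>
     queue_ok u (seen m) (m QUEUE) (m TAIL 0) \<and> explored (seen m) (m QUEUE) h \<and>
     g \<le> m TAIL 0 \<and> m 6 0 = of_bool (\<exists>j<g. (m QUEUE j, v) \<in> (core a b)\<^sup>*)"

text \<open>Marks are distinct window positions. This bounds the number of rounds as well as the
  queue addresses.\<close>

lemma tail_le:
  assumes "queue_ok u S Q q"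
  shows "q \<le> Suc (b - a)" "q < N"
proof -
  have "card S \<le> b - a"
    using assms card_mono[of "{a..<b}" S] by (auto simp: queue_ok_def)
  then show "q \<le> Suc (b - a)" using assms by (simp add: queue_ok_def)
  with window show "q < N" by (simp add: N_def)
qed

lemma runs_visit:
  assumes ok: "search_ok u v h h m" and "v < n" and h: "h < m TAIL 0"
  shows "runs w visit m 50 (\<lambda>m'. search_ok u v h (Suc h) m' \<and> m' CUR 0 = m' QUEUE h \<and> h < m' TAIL 0)"
proof (rule runs_loop_free)
  let ?z = "m QUEUE h"
  have z: "?z < n" using ok h by (auto simp: search_ok_def queue_ok_def)
  have less: "a < N" "b < N" "?z < N" "v < N" using window T_less n_less z \<open>v < n\<close> by auto
  have tab: "m HEAD 0 = h" "m LO 0 = a" "m HI 0 = b" "m BASE 0 = N" "m 5 2 = v"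
    "m REACH (code a b ?z v) = of_bool ((?z, v) \<in> (core a b)\<^sup>*)"
    using ok z \<open>v < n\<close> window
    by (auto simp: search_ok_def state_ok_def tables_ok_def sizes_ok_def reach_ok_def)
  define m1 where "m1 = store m CUR 0 ?z"
  have r: "result w visit m = (if (?z, v) \<in> (core a b)\<^sup>* then store m1 6 0 1 else m1)"
    using two_less by (simp add: visit_def m1_def tab eval_at4 less store_def)
  then have "agree_off {6, CUR} m (result w visit m)"
    by (auto simp: agree_off_def m1_def store_def)
  then have "state_ok occ a b (result w visit m)"
    using ok by - (rule state_ok_agree[of occ a b m "{6, CUR}"], auto simp: search_ok_def)
  then show "search_ok u v h (Suc h) (result w visit m) \<and> result w visit m CUR 0 = result w visit m QUEUE h
      \<and> h < result w visit m TAIL 0"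
    using r ok h by (auto simp: search_ok_def m1_def store_def seen_def less_Suc_eq)
qed (simp_all add: visit_def)

lemma runs_explore:
  assumes ok: "search_ok u v h (Suc h) m" and cur: "m CUR 0 = m QUEUE h" and h: "h < m TAIL 0"
  shows "runs w explore m ((b - a) * 120 + 20)
    (\<lambda>m'. search_ok u v h (Suc h) m' \<and> explored (seen m') (m' QUEUE) (Suc h))"
proof -
  define c where "c = (If (Read SEEN (Var WIN)) Skip
    (If (WinKey <\<^sub>e NV *\<^sub>e NV)
    (If ((Read 1 WinKey +\<^sub>e Read OCC WinKey) %\<^sub>e Const 2)
    (If (Read REACH (at4 (Var LO) (Var HI) (Var CUR) (WinKey /\<^sub>e NV)))
      (Seq (Write SEEN (Var WIN) (Const 1))
      (Seq (Write QUEUE (Var TAIL) (WinKey %\<^sub>e NV))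
        (Write TAIL (Const 0) (Var TAIL +\<^sub>e Const 1))))
    Skip) Skip) Skip))"
  have limit: "time_limit c \<le> 100" "loop_free c" by (simp_all add: c_def)
  have writes: "writes c = {SEEN, QUEUE, TAIL}" by (auto simp: c_def)
  \<comment> \<open>The last clause says that the scan for the current entry is complete for
    positions below \<open>i\<close>.\<close>
  define J where "J i m' \<longleftrightarrow> search_ok u v h (Suc h) m' \<and> m' CUR 0 = m' QUEUE h \<and> h < m' TAIL 0 \<and>
    (\<forall>j\<in>extra. j < i \<longrightarrow> (m' QUEUE h, ks ! j div n) \<in> (core a b)\<^sup>* \<longrightarrow> j \<in> seen m')" for i m'
  have st: "m LO 0 = a" "m HI 0 = b" using ok by (auto simp: search_ok_def state_ok_def)
  show ?thesis
    unfolding explore_def c_def[symmetric]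
  proof (rule runs_weaken[OF runs_For[where s = a and L = b and B = 100 and I = J]])
    fix i m' assume i: "a \<le> i" "i < b" "m' WIN 0 = i" and J: "J i m'"
    let ?k = "ks ! i" and ?z = "m' QUEUE h"
    from J have ok': "search_ok u v h (Suc h) m'" by (simp add: J_def)
    have "i < T" using i window by simp
    then have k: "?k \<le> n * n" by (rule key_le)
    have z: "?z < n" "m' CUR 0 = ?z" using J ok' by (auto simp: J_def search_ok_def queue_ok_def)
    have q: "m' TAIL 0 < N" using ok' tail_le by (auto simp: search_ok_def)
    have tab: "m' LO 0 = a" "m' HI 0 = b" "m' BASE 0 = N" "m' 0 0 = n" "m' KEYS i = ?k" "m' OCC ?k = occ ?k"
      using ok' \<open>i < T\<close> k
      by (auto simp: search_ok_def state_ok_def tables_ok_def sizes_ok_def keys_ok_def)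
    have nn: "n * n < 2 ^ w" by (intro small(1)) (simp add: N_def)
    \<comment> \<open>\<open>go\<close> combines the tests of the nested conditionals, so the body
      has only two outcomes.\<close>
    define go where "go \<longleftrightarrow> i \<notin> seen m' \<and> i \<in> extra \<and> (?z, ?k div n) \<in> (core a b)\<^sup>*"
    have r: "result w c m' = (if go
      then store (store (store m' SEEN i 1) QUEUE (m' TAIL 0) (?k mod n)) TAIL 0 (Suc (m' TAIL 0)) else m')"
    proof (cases "m' SEEN i = 0 \<and> ?k < n * n")
      case False
      then have "\<not> go" using i by (auto simp: go_def seen_def extra_def)
      moreover have "result w c m' = m'"
        using False two_less nn by (auto simp: c_def tab i)
      ultimately show ?thesis by simp
    next
      case True
      have less: "a < N" "b < N" "?z < N" "?k div n < N" "?k div n < n"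
        using window T_less n_less z edge_div_mod[of ?k] True by auto
      have tab2: "m' (Suc 0) ?k = adj ?k"
        "m' REACH (code a b ?z (?k div n)) = of_bool ((?z, ?k div n) \<in> (core a b)\<^sup>*)"
        using ok' True less z window
        by (auto simp: search_ok_def state_ok_def tables_ok_def adj_ok_def reach_ok_def)
      have "adj ?k + occ ?k < 2 ^ w"
        using adj[of ?k] occ[OF k] cnt_le[of ks b ?k] window True
        by (intro small(2)) (simp add: N_def)
      then have par: "eval w m' ((Read 1 WinKey +\<^sub>e Read OCC WinKey) %\<^sub>e Const 2) = (adj ?k + occ ?k) mod 2"
        using two_less by (simp add: tab tab2 i)
      have kw: "?k < 2 ^ w" using True nn by simp
      have at: "eval w m' (at4 (Var LO) (Var HI) (Var CUR) (WinKey /\<^sub>e NV)) = code a b ?z (?k div n)"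
        using less kw by (simp add: eval_at4 tab z(2) i)
      have "go \<longleftrightarrow> odd (adj ?k + occ ?k) \<and> (?z, ?k div n) \<in> (core a b)\<^sup>*"
        using True i by (auto simp: go_def seen_def extra_def)
      moreover have "eval w m' ((Read 1 WinKey +\<^sub>e Read OCC WinKey) %\<^sub>e Const 2) \<noteq> 0 \<longleftrightarrow> odd (adj ?k + occ ?k)"
        unfolding par mod_2_eq_odd by simp
      moreover have "eval w m' (WinKey <\<^sub>e NV *\<^sub>e NV) \<noteq> 0"
        using True two_less nn by (simp add: tab i)
      moreover have "eval w m' (Read SEEN (Var WIN)) = 0" using True i by simp
      moreover have "eval w m' (Read REACH (at4 (Var LO) (Var HI) (Var CUR) (WinKey /\<^sub>e NV)))
        = of_bool ((?z, ?k div n) \<in> (core a b)\<^sup>*)" using at tab2 by simp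
      moreover have "result w (Seq (Write SEEN (Var WIN) (Const 1))
        (Seq (Write QUEUE (Var TAIL) (WinKey %\<^sub>e NV)) (Write TAIL (Const 0) (Var TAIL +\<^sub>e Const 1)))) m' =
        store (store (store m' SEEN i 1) QUEUE (m' TAIL 0) (?k mod n)) TAIL 0 (Suc (m' TAIL 0))"
        using two_less kw q small(2)[of "Suc (m' TAIL 0)"] by (simp add: store_def tab i)
      ultimately show ?thesis
        unfolding c_def by (simp del: eval.simps result.simps add: result.simps(3,4))
    qed
    have "J (Suc i) (result w c m')"
    proof (cases go)
      case False
      then show ?thesis using r J i by (auto simp: J_def go_def less_Suc_eq)
    next
      case True
      let ?m = "result w c m'"
      have r': "?m = store (store (store m' SEEN i 1) QUEUE (m' TAIL 0) (?k mod n)) TAIL 0 (Suc (m' TAIL 0))"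
        using r True by simp
      have seen: "seen ?m = insert i (seen m')" using i by (auto simp: r' seen_def store_def)
      have qt: "?m QUEUE = (m' QUEUE)(m' TAIL 0 := ?k mod n)" "?m TAIL 0 = Suc (m' TAIL 0)"
        "?m CUR = m' CUR" "?m HEAD = m' HEAD" "?m 5 = m' 5" "?m 6 = m' 6"
        by (simp_all add: r' store_def)
      have hq: "h < m' TAIL 0" using J by (simp add: J_def)
      have "agree_off {SEEN, QUEUE, TAIL} m' ?m" by (auto simp: r' agree_off_def store_def)
      then have "state_ok occ a b ?m"
        using ok' by - (rule state_ok_agree[of occ a b m' "{SEEN, QUEUE, TAIL}"], auto simp: search_ok_def)
      moreover have "queue_ok u (seen ?m) (?m QUEUE) (?m TAIL 0)"
        unfolding seen qt using True ok' hq by (intro queue_ok_push) (auto simp: go_def search_ok_def)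
      moreover have "explored (seen ?m) (?m QUEUE) h"
        unfolding seen qt using ok' by (intro explored_push) (auto simp: search_ok_def)
      \<comment> \<open>The new entry is appended behind index \<open>h\<close>, so earlier
        comparisons keep their outcome.\<close>
      moreover have "(\<exists>j<Suc h. (?m QUEUE j, v) \<in> (core a b)\<^sup>*) \<longleftrightarrow> (\<exists>j<Suc h. (m' QUEUE j, v) \<in> (core a b)\<^sup>*)"
      proof -
        have "?m QUEUE j = m' QUEUE j" if "j < Suc h" for j unfolding qt using hq that by simp
        then show ?thesis by metis
      qed
      ultimately have "search_ok u v h (Suc h) ?m"
        using ok' unfolding search_ok_def by (simp add: qt)
      then show ?thesis using J hq unfolding J_def seen by (auto simp: qt less_Suc_eq)
    qed
    then show "runs w c m' 100 (J (Suc i))" by (intro runs_loop_free limit)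
  next
    show "J a m" using ok cur h by (auto simp: J_def extra_def)
    fix m' assume "J b m'"
    then show "search_ok u v h (Suc h) m' \<and> explored (seen m') (m' QUEUE) (Suc h)"
      by (auto simp: J_def search_ok_def explored_def extra_def less_Suc_eq)
  next
    fix i m' x assume J: "J i m'"
    have "state_ok occ a b (store m' WIN 0 x)"
      using J by - (rule state_ok_agree[of occ a b m' "{WIN}"], auto simp: J_def search_ok_def agree_off_def store_def)
    with J show "J i (store m' WIN 0 x)"
      by (simp add: J_def search_ok_def seen_def store_def)
  qed (use st window T_less small(1)[of b] in \<open>auto simp: writes agree_off_def\<close>)
qed

text \<open>At most \<open>Suc (b - a)\<close> entries leave the queue, and each of them scans the
  \<open>b - a\<close> window positions; hence the square.\<close>

lemma runs_search:
  assumes st: "state_ok occ a b m" and uv: "m 5 1 = u" "m 5 2 = v" "u < n" "v < n"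
  shows "runs w search m (1000 * (Suc (b - a))\<^sup>2) (\<lambda>m'. m' 6 0 = of_bool ((u, v) \<in> graph\<^sup>*))"
proof -
  let ?K = "b - a"
  let ?init = "Seq (Write QUEUE (Const 0) (Read 5 (Const 1))) (Seq (Write HEAD (Const 0) (Const 0))
    (Seq (Write TAIL (Const 0) (Const 1)) (Write 6 (Const 0) (Const 0))))"
  let ?e = "Var HEAD <\<^sub>e Var TAIL"
  let ?body = "Seq visit (Seq explore (Write HEAD (Const 0) (Var HEAD +\<^sub>e Const 1)))"
  let ?B = "50 + ((?K * 120 + 20) + 10)"
  have lohi: "m LO 0 = a" "m HI 0 = b" using st by (auto simp: state_ok_def)
  have step: "h < Suc ?K \<and> runs w ?body m' ?B (search_ok u v (Suc h) (Suc h))"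
    if ok: "search_ok u v h h m'" and ne: "eval w m' ?e \<noteq> 0" for h m'
  proof
    have hq: "h < m' TAIL 0" using ok ne by (cases "h < m' TAIL 0") (auto simp: search_ok_def)
    then show "h < Suc ?K" using tail_le(1) ok by (fastforce simp: search_ok_def)
    show "runs w ?body m' ?B (search_ok u v (Suc h) (Suc h))"
    proof (rule runs_Seq)
      show "runs w visit m' 50 (\<lambda>m'. search_ok u v h (Suc h) m' \<and> m' CUR 0 = m' QUEUE h \<and> h < m' TAIL 0)"
        using ok uv(4) hq by (rule runs_visit)
      fix m1 assume "search_ok u v h (Suc h) m1 \<and> m1 CUR 0 = m1 QUEUE h \<and> h < m1 TAIL 0"
      then have m1: "search_ok u v h (Suc h) m1" "m1 CUR 0 = m1 QUEUE h" "h < m1 TAIL 0" by auto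
      show "runs w (Seq explore (Write HEAD (Const 0) (Var HEAD +\<^sub>e Const 1))) m1
        ((?K * 120 + 20) + 10) (search_ok u v (Suc h) (Suc h))"
      proof (rule runs_Seq)
        show "runs w explore m1 (?K * 120 + 20)
          (\<lambda>m'. search_ok u v h (Suc h) m' \<and> explored (seen m') (m' QUEUE) (Suc h))"
          using m1 by (rule runs_explore)
        fix m2 assume m2: "search_ok u v h (Suc h) m2 \<and> explored (seen m2) (m2 QUEUE) (Suc h)"
        then have "m2 TAIL 0 < N" "Suc h \<le> m2 TAIL 0" using tail_le(2) by (auto simp: search_ok_def)
        then have "Suc h < 2 ^ w" by (intro small(1)) simp
        then have r: "result w (Write HEAD (Const 0) (Var HEAD +\<^sub>e Const 1)) m2 = store m2 HEAD 0 (Suc h)"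
          using m2 two_less by (simp add: search_ok_def)
        have "state_ok occ a b (store m2 HEAD 0 (Suc h))"
          using m2 by - (rule state_ok_agree[of occ a b m2 "{HEAD}"], auto simp: search_ok_def agree_off_def store_def)
        then have "search_ok u v (Suc h) (Suc h) (store m2 HEAD 0 (Suc h))"
          using m2 by (simp add: search_ok_def seen_def store_def)
        then show "runs w (Write HEAD (Const 0) (Var HEAD +\<^sub>e Const 1)) m2 10 (search_ok u v (Suc h) (Suc h))"
          unfolding r[symmetric] by (intro runs_loop_free) simp_all
      qed
    qed
  qed
  have "runs w search m ((?K * 30 + 30) + (20 + (Suc ?K * (?B + 10) + 10)))
    (\<lambda>m'. m' 6 0 = of_bool ((u, v) \<in> graph\<^sup>*))"
    unfolding search_def
  proof (rule runs_Seq)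
    show "runs w (For WIN (Var LO) (Var HI) (Write SEEN (Var WIN) (Const 0))) m (?K * 30 + 30)
      (\<lambda>m'. seen m' = {})"
    proof (rule runs_weaken[OF runs_For[where s = a and L = b and B = 10 and
            I = "\<lambda>i m'. \<forall>j. a \<le> j \<longrightarrow> j < i \<longrightarrow> m' SEEN j = 0"]])
      fix i m' assume "m' WIN 0 = i" "\<forall>j. a \<le> j \<longrightarrow> j < i \<longrightarrow> m' SEEN j = 0"
      then show "runs w (Write SEEN (Var WIN) (Const 0)) m' 10 (\<lambda>m'. \<forall>j. a \<le> j \<longrightarrow> j < Suc i \<longrightarrow> m' SEEN j = 0)"
        by (intro runs_loop_free) (auto simp: store_def less_Suc_eq)
    qed (use lohi window T_less small(1)[of b] in \<open>auto simp: agree_off_def store_def seen_def\<close>)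
    fix m1 assume m1: "agree_off (writes (For WIN (Var LO) (Var HI) (Write SEEN (Var WIN) (Const 0)))) m m1"
      "seen m1 = {}"
    from m1(1) have ag1: "agree_off {WIN, SEEN} m m1" by simp
    then have in1: "m1 5 = m 5" by (auto simp: agree_off_def)
    have st1: "state_ok occ a b m1" using st ag1 by (rule state_ok_agree) auto
    show "runs w (Seq ?init (While ?e ?body)) m1 (20 + (Suc ?K * (?B + 10) + 10))
      (\<lambda>m'. m' 6 0 = of_bool ((u, v) \<in> graph\<^sup>*))"
    proof (rule runs_Seq)
      let ?m2 = "store (store (store (store m1 QUEUE 0 u) HEAD 0 0) TAIL 0 1) 6 0 0"
      have r: "result w ?init m1 = ?m2"
        using two_less uv in1 by (simp add: store_def)
      have "state_ok occ a b ?m2"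
        using st1 by - (rule state_ok_agree[of occ a b m1 "{QUEUE, HEAD, TAIL, 6}"], auto simp: agree_off_def store_def)
      moreover have "seen ?m2 = {}" using m1(2) by (simp add: seen_def store_def)
      ultimately have "search_ok u v 0 0 ?m2"
        using uv in1 by (simp add: search_ok_def queue_ok_def explored_def store_def)
      then show "runs w ?init m1 20 (search_ok u v 0 0)"
        unfolding r[symmetric] by (intro runs_loop_free) simp_all
      fix m2 assume "search_ok u v 0 0 m2"
      then have "runs w (While ?e ?body) m2 ((Suc ?K - 0) * (?B + 1 + cost ?e) + (1 + cost ?e))
          (\<lambda>m'. \<exists>h. search_ok u v h h m' \<and> eval w m' ?e = 0)"
        using step by (intro runs_While) auto
      then show "runs w (While ?e ?body) m2 (Suc ?K * (?B + 10) + 10)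
          (\<lambda>m'. m' 6 0 = of_bool ((u, v) \<in> graph\<^sup>*))"
      proof (rule runs_weaken)
        fix m3 assume "\<exists>h. search_ok u v h h m3 \<and> eval w m3 ?e = 0"
        then obtain h where ok: "search_ok u v h h m3" and "eval w m3 ?e = 0" by blast
        \<comment> \<open>The queue is exhausted: all entries have been explored and compared with
          \<open>v\<close>.\<close>
        then have "h = m3 TAIL 0"
          using two_less by (cases "h < m3 TAIL 0") (auto simp: search_ok_def)
        then show "m3 6 0 = of_bool ((u, v) \<in> graph\<^sup>*)"
          using ok reachable_iff_queue[of u "seen m3" "m3 QUEUE" h v] by (auto simp: search_ok_def)
      qed (simp add: algebra_simps)
    qed
  qed
  then show ?thesis
  proof (rule runs_weaken)
    show "(?K * 30 + 30) + (20 + (Suc ?K * (?B + 10) + 10)) \<le> 1000 * (Suc ?K)\<^sup>2"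
      by (simp add: power2_eq_square algebra_simps)
  qed
qed

end

section \<open>The invariant along the whole request sequence\<close>

section \<open>Serving a request sequence\<close>

text \<open>All queries share the key \<open>n * n\<close>, which is not the index of an edge.\<close>

fun key :: "nat \<Rightarrow> request \<Rightarrow> nat" where
  "key n (Query u v) = n * n"
| "key n r = src r * n + tgt r"

lemma valid_requests_bounds:
  "valid_requests n G \<rho> \<Longrightarrow> r \<in> set \<rho> \<Longrightarrow> src r < n \<and> tgt r < n"
  by (induction \<rho> arbitrary: G) auto

lemma key_le_square: "src r < n \<Longrightarrow> tgt r < n \<Longrightarrow> key n r \<le> n * n"
  using pair_less[of "src r" n "tgt r" n] by (cases r) (auto intro: less_imp_le)

lemma cnt_min: "cnt ks (min i (length ks)) e = cnt ks i e"
  by (simp add: cnt_def min_def)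

lemma writes_handlers: "writes advance = {NEXT, OCC, HI, LO}"
  "writes search = {WIN, SEEN, QUEUE, HEAD, TAIL, 6, CUR}"
  by (auto simp: advance_def search_def visit_def explore_def)

context prediction
begin

text \<open>The exported constant does not take \<open>a\<close> and \<open>b\<close>: the current
  graph is independent of the window.\<close>

abbreviation graph_of :: "(nat \<Rightarrow> nat) \<Rightarrow> digraph" where
  "graph_of occ \<equiv> window.graph n adj occ"

lemma graph_of_iff:
  assumes "window w n T ks adj N occ a b"
  shows "(x, y) \<in> graph_of occ \<longleftrightarrow> x < n \<and> y < n \<and> odd (adj (x * n + y) + occ (x * n + y))"
  using window.graph_def[OF assms] by simp

text \<open>By admissibility, an insertion meets an absent edge and a deletion a present one, so
  both flip the parity. A query raises only the count of \<open>n * n\<close>, which encodes no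
  edge.\<close>

lemma apply_request_graph:
  assumes W: "window w n T ks adj N occ a b" "window w n T ks adj N occ' a' b'"
    and r: "src r < n" "tgt r < n" "admissible r (graph_of occ)"
    and occ': "occ' = occ(key n r := Suc (occ (key n r)))"
  shows "apply_request r (graph_of occ) = graph_of occ'"
proof -
  have occ'_app: "occ' e = (if e = key n r then Suc (occ e) else occ e)" for e
    using occ' by simp
  have "(x, y) \<in> apply_request r (graph_of occ) \<longleftrightarrow> (x, y) \<in> graph_of occ'" for x y
  proof (cases "x < n \<and> y < n")
    case True
    then have less: "x * n + y < n * n" by (simp add: edge_less)
    show ?thesis
    proof (cases r)
      case (Query u v)
      with less show ?thesis
        by (auto simp: graph_of_iff[OF W(1)] graph_of_iff[OF W(2)] occ'_app)
    next
      case (Insert u v)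
      then show ?thesis using r True pair_eq_iff[of y n v x u]
        by (auto simp: graph_of_iff[OF W(1)] graph_of_iff[OF W(2)] occ'_app)
    next
      case (Delete u v)
      then show ?thesis using r True pair_eq_iff[of y n v x u]
        by (auto simp: graph_of_iff[OF W(1)] graph_of_iff[OF W(2)] occ'_app)
    qed
  next
    case False
    then show ?thesis using r
      by (cases r) (auto simp: graph_of_iff[OF W(1)] graph_of_iff[OF W(2)])
  qed
  then show ?thesis by auto
qed

text \<open>Induction on the number of remaining requests. The lower end satisfies
  \<open>t \<le> a + d\<close>, a form without truncated subtraction, and \<open>a \<le> t\<close>
  gives \<open>a < T\<close> while a request remains.\<close>

lemma serves_suffix:
  assumes del: "delayed d \<rho> \<rho>h" and ks: "ks = map (key n) \<rho>h" and ls: "ls = map (key n) \<rho>"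
    and "window w n T ks adj N (cnt ls t) a b" "state_ok (cnt ls t) a b m"
    and "t \<le> a + d" "a \<le> t" "b \<le> t + d" "t \<le> T"
    and "valid_requests n (graph_of (cnt ls t)) (drop t \<rho>)"
  shows "serves w closure_algorithm 200 (10000 * (max 1 d)\<^sup>2) (graph_of (cnt ls t)) (drop t \<rho>) m"
  using assms(4-)
proof (induction "T - t" arbitrary: t a b m)
  case 0
  then have "drop t \<rho> = []" using delayed_length[OF del] len ks by simp
  then show ?case by simp
next
  case (Suc s)
  note W = Suc.prems(1) and st = Suc.prems(2) and d = Suc.prems(3-6) and valid = Suc.prems(7)
  have lens: "length \<rho> = T" "length ls = T" using delayed_length[OF del] len ks ls by simp_all
  have "t < T" using Suc.hyps(2) by simp
  define r where "r = \<rho> ! t"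
  define k where "k = key n r"
  have drop: "drop t \<rho> = r # drop (Suc t) \<rho>"
    using \<open>t < T\<close> lens by (simp add: r_def Cons_nth_drop_Suc)
  have r: "src r < n" "tgt r < n" "admissible r (graph_of (cnt ls t))"
    and valid': "valid_requests n (apply_request r (graph_of (cnt ls t))) (drop (Suc t) \<rho>)"
    using valid unfolding drop by simp_all
  have k: "k \<le> n * n" unfolding k_def using r by (intro key_le_square)
  have "ls ! t = k" using \<open>t < T\<close> lens by (simp add: ls r_def k_def)
  then have occ': "cnt ls (Suc t) = (cnt ls t)(k := Suc (cnt ls t k))"
    using \<open>t < T\<close> lens by (auto simp: cnt_Suc fun_eq_iff)
  \<comment> \<open>The arriving occurrence is among the first \<open>Suc t + d\<close> predictions;
    this yields \<open>p\<close> and later \<open>b' \<le> Suc t + d\<close>. The minimum with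
    \<open>T\<close> meets the range condition of \<open>occurrence_exists\<close>.\<close>
  have "cnt ls t k < cnt ls (Suc t) k" by (simp add: occ')
  also have "\<dots> \<le> cnt ks (Suc t + d) k" unfolding ks ls by (rule delayed_cnt[OF del])
  also have "\<dots> = cnt ks (min (Suc t + d) T) k" using cnt_min[of ks] len by simp
  finally obtain p where p: "p < min (Suc t + d) T" "ks ! p = k" "cnt ks p k = cnt ls t k"
    using occurrence_exists[of "cnt ls t k" ks "min (Suc t + d) T" k] len by auto
  have "a < T" using d \<open>t < T\<close> by simp
  define a' where "a' = (if cnt ks a (ks ! a) < cnt ls (Suc t) (ks ! a) then Suc a else a)"
  define b' where "b' = max (max b (Suc p)) a'"
  have adv: "window w n T ks adj N (cnt ls (Suc t)) a' b' \<and>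
      runs w advance m1 100 (state_ok (cnt ls (Suc t)) a' b')"
    if "state_ok (cnt ls t) a b m1" "m1 KEY 0 = k" for m1
    using runs_advance[OF W that(1) \<open>a < T\<close> that(2) k _ p(2,3)] p(1)
    unfolding a'_def b'_def occ' by simp
  have d': "Suc t \<le> a' + d"
  proof (cases "cnt ks a (ks ! a) < cnt ls (Suc t) (ks ! a)")
    \<comment> \<open>A blocked lower end means that the occurrence at \<open>a\<close> is still
      missing after \<open>Suc t\<close> requests, although it must be there after
      \<open>Suc a + d\<close>.\<close>
    case False
    then have "cnt ls (Suc t) (ks ! a) < cnt ks (Suc a) (ks ! a)"
      using \<open>a < T\<close> len by (simp add: cnt_Suc)
    also have "\<dots> \<le> cnt ls (Suc a + d) (ks ! a)" unfolding ks ls by (rule delayed_cnt[OF del])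
    finally have "\<not> Suc a + d \<le> Suc t" using cnt_mono[of "Suc a + d" "Suc t" ls] leD by blast
    then show ?thesis using False by (simp add: a'_def)
  qed (use d in \<open>simp add: a'_def\<close>)
  have d'': "a' \<le> Suc t" "b' \<le> Suc t + d" using d p by (auto simp: a'_def b'_def)
  define m0 where "m0 = load_request w r m"
  have ag0: "agree_off {5} m m0" by (auto simp: m0_def load_request_def agree_off_def store_def)
  have st0: "state_ok (cnt ls t) a b m0" using st ag0 by (rule state_ok_agree) auto
  have in0: "m0 5 1 = src r" "m0 5 2 = tgt r"
    using r n_less small(1)[of "src r"] small(1)[of "tgt r"] by (auto simp: m0_def load_request_def store_def)
  have n0: "m0 0 0 = n" using st0 by (auto simp: state_ok_def tables_ok_def sizes_ok_def)
  have kw: "k < 2 ^ w" using k by (intro small(1)) (simp add: N_def)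
  have keyed: "runs w (Seq (Write KEY (Const 0) e) advance) m0 (20 + 100) (state_ok (cnt ls (Suc t)) a' b')"
    if "eval w m0 e = k" "cost e < 15" for e
  proof (rule runs_Seq)
    show "runs w (Write KEY (Const 0) e) m0 20 (\<lambda>m'. m' = store m0 KEY 0 k)"
      using that by (intro runs_loop_free) auto
    fix m' assume m': "m' = store m0 KEY 0 k"
    then have "agree_off {KEY} m0 m'" by (simp add: agree_off_def store_def)
    with st0 have "state_ok (cnt ls t) a b m'" by (rule state_ok_agree) auto
    then show "runs w advance m' 100 (state_ok (cnt ls (Suc t)) a' b')"
      using adv[of m'] m' by (simp add: store_def)
  qed
  \<comment> \<open>\<open>adv\<close> gives the window together with a run, so some memory with the
    key loaded is needed to extract it.\<close>
  have "state_ok (cnt ls t) a b (store m0 KEY 0 k)"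
    using st0 by (rule state_ok_agree[where K = "{KEY}"]) (auto simp: agree_off_def store_def)
  then have W': "window w n T ks adj N (cnt ls (Suc t)) a' b'"
    using adv by (auto simp: store_def)
  have G': "apply_request r (graph_of (cnt ls t)) = graph_of (cnt ls (Suc t))"
    using W W' r occ' unfolding k_def by (rule apply_request_graph)
  have "runs w (handler closure_algorithm r) m0 (time_bound 200 (10000 * (max 1 d)\<^sup>2) r)
    (\<lambda>m'. correct_answer r (graph_of (cnt ls t)) m' \<and> state_ok (cnt ls (Suc t)) a' b' m')"
  proof (cases r)
    case (Query u v)
    let ?e = "NV *\<^sub>e NV"
    have ke: "eval w m0 ?e = k" using n0 kw Query by (simp add: k_def)
    have "runs w (Seq (Seq (Write KEY (Const 0) ?e) advance) search) m0
      ((20 + 100) + 1000 * (Suc (b' - a'))\<^sup>2)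
      (\<lambda>m'. correct_answer r (graph_of (cnt ls t)) m' \<and> state_ok (cnt ls (Suc t)) a' b' m')"
    proof (rule runs_Seq)
      show "runs w (Seq (Write KEY (Const 0) ?e) advance) m0 (20 + 100) (state_ok (cnt ls (Suc t)) a' b')"
        using ke by (intro keyed) simp_all
      fix m1 assume ag1: "agree_off (writes (Seq (Write KEY (Const 0) ?e) advance)) m0 m1"
        and st1: "state_ok (cnt ls (Suc t)) a' b' m1"
      have "m1 5 = m0 5" using ag1 by (auto simp: agree_off_def writes_handlers)
      then have "m1 5 1 = u" "m1 5 2 = v" "u < n" "v < n" using in0 r Query by simp_all
      from window.runs_search[OF W' st1 this]
      show "runs w search m1 (1000 * (Suc (b' - a'))\<^sup>2)
        (\<lambda>m'. correct_answer r (graph_of (cnt ls t)) m' \<and> state_ok (cnt ls (Suc t)) a' b' m')"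
      proof (rule runs_weaken)
        fix m2 assume ag2: "agree_off (writes search) m1 m2"
          and ans: "m2 6 0 = of_bool ((u, v) \<in> (graph_of (cnt ls (Suc t)))\<^sup>*)"
        have "state_ok (cnt ls (Suc t)) a' b' m2"
          using st1 ag2 by (rule state_ok_agree) (auto simp: writes_handlers)
        \<comment> \<open>The search runs after advancing, but a query leaves the graph
          unchanged.\<close>
        moreover have "graph_of (cnt ls (Suc t)) = graph_of (cnt ls t)" using G' Query by simp
        ultimately show "correct_answer r (graph_of (cnt ls t)) m2 \<and> state_ok (cnt ls (Suc t)) a' b' m2"
          using ans Query by simp
      qed simp
    qed
    moreover have "handler closure_algorithm r = Seq (Seq (Write KEY (Const 0) ?e) advance) search"
      by (simp add: Query closure_algorithm_def)
    ultimately show ?thesis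
    proof (elim ssubst runs_weaken)
      \<comment> \<open>The window has length at most \<open>2 * d\<close>; the maximum covers
        \<open>d = 0\<close>. Squaring gives the factor 9, and 10000 absorbs the 120 steps before
        the search.\<close>
      have "Suc (b' - a') \<le> 3 * max 1 d" using d' d'' by simp
      then have "(Suc (b' - a'))\<^sup>2 \<le> (3 * max 1 d)\<^sup>2" by (intro power_mono) auto
      then have "(Suc (b' - a'))\<^sup>2 \<le> 9 * (max 1 d)\<^sup>2" by (simp add: power_mult_distrib)
      moreover have "1 \<le> (max 1 d)\<^sup>2" by simp
      ultimately show "(20 + 100) + 1000 * (Suc (b' - a'))\<^sup>2 \<le> time_bound 200 (10000 * (max 1 d)\<^sup>2) r"
        unfolding Query time_bound.simps by linarith
    qed
  next
    case (Insert u v)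
    let ?e = "Read 5 (Const 1) *\<^sub>e NV +\<^sub>e Read 5 (Const 2)"
    have "eval w m0 ?e = k" using n0 kw Insert in0 two_less by (simp add: k_def mod_simps)
    then have "runs w (Seq (Write KEY (Const 0) ?e) advance) m0 (20 + 100) (state_ok (cnt ls (Suc t)) a' b')"
      by (rule keyed) simp
    moreover have "handler closure_algorithm r = Seq (Write KEY (Const 0) ?e) advance"
      by (simp add: Insert closure_algorithm_def)
    ultimately show ?thesis
      by (elim ssubst runs_weaken) (simp_all add: Insert)
  next
    case (Delete u v)
    let ?e = "Read 5 (Const 1) *\<^sub>e NV +\<^sub>e Read 5 (Const 2)"
    have "eval w m0 ?e = k" using n0 kw Delete in0 two_less by (simp add: k_def mod_simps)
    then have "runs w (Seq (Write KEY (Const 0) ?e) advance) m0 (20 + 100) (state_ok (cnt ls (Suc t)) a' b')"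
      by (rule keyed) simp
    moreover have "handler closure_algorithm r = Seq (Write KEY (Const 0) ?e) advance"
      by (simp add: Delete closure_algorithm_def)
    ultimately show ?thesis
      by (elim ssubst runs_weaken) (simp_all add: Delete)
  qed
  then obtain \<tau> m' where run: "exec w (handler closure_algorithm r) m0 \<tau> m'"
    "\<tau> \<le> time_bound 200 (10000 * (max 1 d)\<^sup>2) r" "correct_answer r (graph_of (cnt ls t)) m'"
    and st': "state_ok (cnt ls (Suc t)) a' b' m'"
    unfolding runs_def by blast
  have "serves w closure_algorithm 200 (10000 * (max 1 d)\<^sup>2) (graph_of (cnt ls (Suc t))) (drop (Suc t) \<rho>) m'"
    using W' st' d' d'' \<open>t < T\<close> valid' Suc.hyps(2) unfolding G' by (intro Suc.hyps(1)) auto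
  with run show ?case unfolding drop m0_def by (auto simp: G')
qed

end

lemma closure_algorithm_solves:
  assumes G: "G \<subseteq> {..<n} \<times> {..<n}" and valid: "valid_requests n G \<rho>" and del: "delayed d \<rho> \<rho>h"
    and N: "N = n * n + length \<rho> + 2" and w: "N ^ 4 < 2 ^ w"
  shows "solves w closure_algorithm n G \<rho>h \<rho> (3000 * N ^ 5) 200 (10000 * (max 1 d)\<^sup>2)"
proof -
  define ks where "ks = map (key n) \<rho>h"
  define ls where "ls = map (key n) \<rho>"
  define adj :: "nat \<Rightarrow> nat" where "adj e = of_bool ((e div n, e mod n) \<in> G)" for e
  let ?T = "length \<rho>"
  have lenh: "length \<rho>h = ?T" using del by (rule delayed_length)
  have bnd: "src r < n" "tgt r < n" if "r \<in> set \<rho>h" for r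
    using valid_requests_bounds[OF valid] that delayed_set[OF del] by auto
  interpret prediction w n ?T ks adj N
    using lenh N w bnd key_le_square by unfold_locales (auto simp: ks_def adj_def)
  let ?m = "initial_mem w n G \<rho>h"
  have W: "window w n ?T ks adj N (cnt ls 0) 0 0" by unfold_locales auto
  have G0: "G = graph_of (cnt ls 0)"
  proof -
    have "(x, y) \<in> G \<longleftrightarrow> (x, y) \<in> graph_of (cnt ls 0)" for x y
      using G by (cases "y < n") (auto simp: graph_of_iff[OF W] adj_def)
    then show ?thesis by auto
  qed
  have "runs w preprocessing ?m (3000 * N ^ 5) tables_ok"
  proof (rule runs_preprocessing)
    show "?m 0 0 = n" "?m 0 1 = ?T"
      using small(1) n_less T_less by (simp_all add: initial_mem_def lenh)
    show "adj_ok ?m" using two_less by (simp add: adj_ok_def initial_mem_def adj_def)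
    show "\<forall>i. ?m COUNT i = 0" by (simp add: initial_mem_def)
    show "\<forall>i<?T. ks ! i = (if ?m 2 i < 2 then ?m 3 i * n + ?m 4 i else n * n)"
    proof (intro allI impI)
      fix i assume i: "i < ?T"
      have "\<rho>h ! i \<in> set \<rho>h" using i lenh by simp
      then have "src (\<rho>h ! i) < 2 ^ w" "tgt (\<rho>h ! i) < 2 ^ w"
        using bnd n_less small(1) less_trans by blast+
      then have "?m 2 i = tag (\<rho>h ! i)" "?m 3 i = src (\<rho>h ! i)" "?m 4 i = tgt (\<rho>h ! i)"
        using i lenh two_less by (cases "\<rho>h ! i"; simp add: initial_mem_def)+
      then show "ks ! i = (if ?m 2 i < 2 then ?m 3 i * n + ?m 4 i else n * n)"
        using i lenh by (cases "\<rho>h ! i") (simp_all add: ks_def)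
    qed
  qed
  then obtain \<tau> m where pre: "exec w preprocessing ?m \<tau> m" "\<tau> \<le> 3000 * N ^ 5" "tables_ok m"
    unfolding runs_def by blast
  have "agree_off (writes preprocessing) ?m m" using pre(1) by (rule exec_agree_off)
  \<comment> \<open>Preprocessing leaves these arrays at 0, which encodes the empty window at the
    start.\<close>
  then have "m LO = ?m LO" "m HI = ?m HI" "m OCC = ?m OCC"
    by (auto simp: agree_off_def writes_preprocessing)
  then have "state_ok (cnt ls 0) 0 0 m" using pre(3) by (simp add: state_ok_def initial_mem_def)
  then have "serves w closure_algorithm 200 (10000 * (max 1 d)\<^sup>2) (graph_of (cnt ls 0)) (drop 0 \<rho>) m"
    using W valid G0 by (intro serves_suffix[OF del ks_def ls_def]) auto
  with pre show ?thesis unfolding solves_def G0[symmetric] by (auto simp: closure_algorithm_def)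
qed

section \<open>From asymptotic bounds to a sufficient word length\<close>

section \<open>Growth rates\<close>

text \<open>The finitely many exceptions of the asymptotic bound are absorbed into \<open>K\<close>
  by adding up their values. The word length must suffice for every \<open>n\<close>, so a bound for
  large \<open>n\<close> is not enough.\<close>

lemma polynomially_bounded_everywhere:
  assumes "polynomially_bounded f"
  shows "\<exists>K k. \<forall>n. f n \<le> K * (n + 1) ^ k"
proof -
  from assms obtain k where "(\<lambda>n. real (f n)) \<in> O(\<lambda>n. real n ^ k)"
    unfolding polynomially_bounded_def by blast
  then obtain c where "eventually (\<lambda>n. norm (real (f n)) \<le> c * norm (real n ^ k)) at_top"
    by (elim landau_o.bigE)
  then obtain n0 where n0: "\<And>n. n \<ge> n0 \<Longrightarrow> real (f n) \<le> c * real n ^ k"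
    by (auto simp: eventually_at_top_linorder)
  define K where "K = nat \<lceil>c\<rceil> + (\<Sum>n<n0. f n)"
  have "f n \<le> K * (n + 1) ^ k" for n
  proof (cases "n < n0")
    case True
    then have "f n \<le> (\<Sum>n<n0. f n)" by (intro member_le_sum) auto
    also have "\<dots> \<le> K * 1" by (simp add: K_def)
    also have "\<dots> \<le> K * (n + 1) ^ k" by (intro mult_le_mono2) simp
    finally show ?thesis .
  next
    case False
    then have "real (f n) \<le> c * real n ^ k" using n0 by simp
    also have "\<dots> \<le> real K * real (n + 1) ^ k"
    proof (intro mult_mono power_mono)
      have "c \<le> real (nat \<lceil>c\<rceil>)" by (rule real_nat_ceiling_ge)
      also have "\<dots> \<le> real K" by (auto simp: K_def intro!: sum_nonneg)
      finally show "c \<le> real K" .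
    qed auto
    finally have "real (f n) \<le> real (K * (n + 1) ^ k)" by simp
    then show ?thesis by (simp only: of_nat_le_iff)
  qed
  then show ?thesis by blast
qed

lemma polynomially_boundedI:
  assumes "\<And>n. f n \<le> K * (n + 1) ^ k"
  shows "polynomially_bounded f"
  unfolding polynomially_bounded_def
proof (intro exI bigoI eventually_at_top_linorderI)
  fix n :: nat assume "1 \<le> n"
  have "real (f n) \<le> real (K * (n + 1) ^ k)" using assms by (simp only: of_nat_le_iff)
  also have "\<dots> = real K * real (n + 1) ^ k" by simp
  also have "\<dots> \<le> real K * (2 * real n) ^ k"
    using \<open>1 \<le> n\<close> by (intro mult_left_mono power_mono) auto
  finally show "norm (real (f n)) \<le> (real K * 2 ^ k) * norm (real n ^ k)"
    by (simp add: power_mult_distrib mult.assoc)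
qed

lemma less_two_power_word_bits: "n < 2 ^ (floor_log n + 1)"
  using floor_log_exp2_gt[of n] by (cases "n = 0") auto

text \<open>With \<open>b = 2 ^ (floor_log n + 1)\<close>, both 2 and \<open>n + 1\<close> are at
  most \<open>b\<close>; hence \<open>K < 2 ^ K \<le> b ^ K\<close> and the polynomial stays below
  \<open>b ^ (K + k + 1)\<close>.\<close>

lemma polynomial_less_two_power_word_bits:
  assumes "m \<le> K * (n + 1) ^ k"
  shows "m < 2 ^ word_bits (K + k + 1) n"
proof -
  define b :: nat where "b = 2 ^ (floor_log n + 1)"
  have b: "n + 1 \<le> b" "2 \<le> b" using less_two_power_word_bits[of n] by (auto simp: b_def)
  have "K < 2 ^ K" by (rule less_exp)
  also have "\<dots> \<le> b ^ K" using b by (intro power_mono) auto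
  finally have "K * (n + 1) ^ k \<le> b ^ K * b ^ k" using b by (intro mult_mono power_mono) auto
  also have "\<dots> < b ^ (K + k + 1)" using b by (auto simp flip: power_add intro!: power_strict_increasing)
  also have "\<dots> = 2 ^ word_bits (K + k + 1) n"
    unfolding b_def word_bits_def power_mult[symmetric] by (simp add: mult.commute)
  finally show ?thesis using assms by simp
qed

text \<open>The program and all constants are chosen before \<open>d\<close>, which expresses that
  the algorithm is not given \<open>d\<close>. With \<open>d = 0\<close> a query still takes
  constant time, hence \<open>max 1 d\<close>.\<close>

theorem theorem8p21:
  fixes T :: "nat \<Rightarrow> nat"
  assumes "polynomially_bounded T"
  shows "\<exists>(A :: algorithm) (c :: nat) (P :: nat \<Rightarrow> nat) (U :: nat \<Rightarrow> nat) (C :: nat).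
    polynomially_bounded P \<and> polylog_bounded U \<and>
    (\<forall>(n :: nat) (G :: digraph) (\<rho> :: request list) (\<rho>h :: request list) (d :: nat).
       G \<subseteq> {..<n} \<times> {..<n} \<longrightarrow> length \<rho> = T n \<longrightarrow> valid_requests n G \<rho> \<longrightarrow> delayed d \<rho> \<rho>h \<longrightarrow>
       solves (word_bits c n) A n G \<rho>h \<rho> (P n) (U n) (C * (max 1 d)\<^sup>2))"
proof -
  from assms obtain K k where T: "\<And>n. T n \<le> K * (n + 1) ^ k"
    using polynomially_bounded_everywhere by blast
  define N where "N n = n * n + T n + 2" for n
  \<comment> \<open>\<open>K\<close> accounts for \<open>T n\<close>, and 3 for \<open>n * n\<close>
    together with the summand 2.\<close>
  have N: "N n \<le> (K + 3) * (n + 1) ^ (k + 2)" for n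
  proof -
    have "T n \<le> K * (n + 1) ^ (k + 2)"
      using T[of n] by (rule order_trans) (intro mult_le_mono2 power_increasing; simp)
    moreover have "n * n \<le> (n + 1) ^ 2" by (simp add: power2_eq_square)
    moreover have "(n + 1) ^ 2 \<le> (n + 1) ^ (k + 2)" by (intro power_increasing) auto
    moreover have "1 \<le> (n + 1) ^ (k + 2)" by (rule one_le_power) simp
    ultimately show ?thesis unfolding N_def distrib_right by linarith
  qed
  have N_power: "N n ^ j \<le> (K + 3) ^ j * (n + 1) ^ ((k + 2) * j)" for n j
    using power_mono[OF N le0, of n j] by (simp only: power_mult_distrib power_mult)
  \<comment> \<open>The constant that \<open>polynomial_less_two_power_word_bits\<close> yields for
    the bound on \<open>N n ^ 4\<close>, the size of the reachability table.\<close>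
  define c where "c = (K + 3) ^ 4 + (k + 2) * 4 + 1"
  have "polynomially_bounded (\<lambda>n. 3000 * N n ^ 5)"
    by (rule polynomially_boundedI[of _ "3000 * (K + 3) ^ 5" "(k + 2) * 5"]) (use N_power[of _ 5] in \<open>simp add: mult.assoc\<close>)
  moreover have "polylog_bounded (\<lambda>_. 200)"
    unfolding polylog_bounded_def by (intro exI[of _ 0]) simp
  moreover have "solves (word_bits c n) closure_algorithm n G \<rho>h \<rho> (3000 * N n ^ 5) 200 (10000 * (max 1 d)\<^sup>2)"
    if "G \<subseteq> {..<n} \<times> {..<n}" "length \<rho> = T n" "valid_requests n G \<rho>" "delayed d \<rho> \<rho>h"
    for n G \<rho> \<rho>h d
    using that polynomial_less_two_power_word_bits[OF N_power[of n 4]]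
    by (intro closure_algorithm_solves) (simp_all add: N_def c_def)
  ultimately show ?thesis by blast
qed

end
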